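(* Let $n_1=\dots=n_d=n^{1/d}$ and fix $k\in[1:\min_{i\in[d]}n_i-1]$. Let $H(d)=\sum_{i=1}^d1/i$. Let $g\in\mathbb{R}^{n^{1/d}\times\cdots\times n^{1/d}}$ be any tensor such that $\mathrm{TV}_k(g)=\mathcal O(1)$. Choose $$\lambda\asymp n^{-\frac{H(d)+2k-1}{2H(d)+2k-1}}\log^{\frac{H(d)}{2H(d)+2k-1}}(n).$$ Then, with probability at least $1-\Theta(1/n)$, it holds that $$\frac{\|(\hat f-f^0)_{\mathcal N_k^\perp}\|_2^2}{n}\le\frac{\|g-f^0_{\mathcal N_k^\perp}\|_2^2}{n}+\mathcal O\!\left(n^{-\frac{H(d)+2k-1}{2H(d)+2k-1}}\log^{\frac{H(d)}{2H(d)+2k-1}}(n)\right).$$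
   Context: Notation: $[i:j]=\{i,\dots,j\}$, $[j]=[1:j]$. For a tensor $a$, $\|a\|_2$ is the Frobenius norm and $\|a\|_1$ the sum of absolute values of the entries. Model: $Y=f^0+\epsilon$ with $Y,f^0,\epsilon\in\mathbb{R}^{n_1\times\cdots\times n_d}$, $n=n_1\cdots n_d$, where $f^0$ is fixed and $\epsilon$ has i.i.d. $\mathcal N(0,\sigma^2)$ entries, $\sigma\in(0,\infty)$ known. Difference operator: the $k$-th order difference along coordinate $i$ is $(D_i^kf)(j_1,\dots,j_d)=n_i^{k-1}\sum_{l=0}^k(-1)^l\binom kl f(j_1,\dots,j_i-l,\dots,j_d)$ for $j_i\in[k+1:n_i]$. The total difference operator is $D^k=\prod_{i=1}^dD_i^k$. The $k$-th order Vitali total variation is $\mathrm{TV}_k(f)=\|D^kf\|_1$. $\mathcal N_k=\{f:D^kf=0\}$, $\mathcal N_k^\perp$ is its orthogonal complement, and $f_{\mathcal N_k^\perp}$ is the orthogonal projection of $f$ onto $\mathcal N_k^\perp$. Estimator: $\hat f_{\mathcal N_k^\perp}:=\arg\min_{\mathrm f}\{\|(Y-\mathrm f)_{\mathcal N_k^\perp}\|_2^2/n+2\lambda\,\mathrm{TV}_k(\mathrm f)\}$, where the objective depends on $\mathrm f$ only through its projection onto $\mathcal N_k^\perp$ and the minimizer is taken in $\mathcal N_k^\perp$ (where it is unique). $(\hat f-f^0)_{\mathcal N_k^\perp}$ means $\hat f_{\mathcal N_k^\perp}-f^0_{\mathcal N_k^\perp}$. Asymptotics are for $n\to\infty$ with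 $k$, $d$, $\sigma$ fixed; the constants in $\asymp$, $\mathcal O$, $\Theta$ may depend on $k,d,\sigma$ and on the bound on $\mathrm{TV}_k(g)$. *)

theory Defs
  imports "HOL-Probability.Probability"
begin

text \<open>
  A tensor in \<open>\<real>\<^bsup>N 1 \<times> \<dots> \<times> N d\<^esup>\<close> is an extensional function on the multi-indices
  \<open>j\<close> with \<open>j i \<in> {1..N i}\<close> for \<open>i \<in> {1..d}\<close>. The side lengths must be allowed to grow
  with constants held fixed, so they are terms rather than index types.
\<close>

definition tensor_index :: "nat \<Rightarrow> (nat \<Rightarrow> nat) \<Rightarrow> (nat \<Rightarrow> nat) set" where
  "tensor_index d N = (\<Pi>\<^sub>E i\<in>{1..d}. {1..N i})"

definition tensors :: "nat \<Rightarrow> (nat \<Rightarrow> nat) \<Rightarrow> ((nat \<Rightarrow> nat) \<Rightarrow> real) set" where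
  "tensors d N = (tensor_index d N \<rightarrow>\<^sub>E UNIV)"

definition tensor_size :: "nat \<Rightarrow> (nat \<Rightarrow> nat) \<Rightarrow> nat" where
  "tensor_size d N = (\<Prod>i=1..d. N i)"

definition tensor_inner ::
  "nat \<Rightarrow> (nat \<Rightarrow> nat) \<Rightarrow> ((nat \<Rightarrow> nat) \<Rightarrow> real) \<Rightarrow> ((nat \<Rightarrow> nat) \<Rightarrow> real) \<Rightarrow> real" where
  "tensor_inner d N f h = (\<Sum>j\<in>tensor_index d N. f j * h j)"

definition frob_norm :: "nat \<Rightarrow> (nat \<Rightarrow> nat) \<Rightarrow> ((nat \<Rightarrow> nat) \<Rightarrow> real) \<Rightarrow> real" where
  "frob_norm d N f = L2_set f (tensor_index d N)"

text \<open>
  \<open>diff_op N k i\<close> is \<open>D\<^sub>i\<^sup>k\<close>. It is only meaningful at \<open>j\<close> with \<open>j i \<in> {k+1..N i}\<close>; elsewhere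
  its value is junk. On \<open>diff_index\<close>, the domain of \<open>D\<^sup>k f\<close>, the composite \<open>total_diff\<close>
  evaluates \<open>f\<close> at multi-indices in \<open>tensor_index\<close> only.
\<close>

definition diff_op ::
  "(nat \<Rightarrow> nat) \<Rightarrow> nat \<Rightarrow> nat \<Rightarrow> ((nat \<Rightarrow> nat) \<Rightarrow> real) \<Rightarrow> (nat \<Rightarrow> nat) \<Rightarrow> real" where
  "diff_op N k i f j =
     real (N i) ^ (k - 1) * (\<Sum>l=0..k. (-1) ^ l * real (k choose l) * f (j(i := j i - l)))"

definition total_diff ::
  "nat \<Rightarrow> (nat \<Rightarrow> nat) \<Rightarrow> nat \<Rightarrow> ((nat \<Rightarrow> nat) \<Rightarrow> real) \<Rightarrow> (nat \<Rightarrow> nat) \<Rightarrow> real" where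
  "total_diff d N k f = foldr (diff_op N k) [1..<Suc d] f"

definition diff_index :: "nat \<Rightarrow> (nat \<Rightarrow> nat) \<Rightarrow> nat \<Rightarrow> (nat \<Rightarrow> nat) set" where
  "diff_index d N k = (\<Pi>\<^sub>E i\<in>{1..d}. {k+1..N i})"

definition TV :: "nat \<Rightarrow> (nat \<Rightarrow> nat) \<Rightarrow> nat \<Rightarrow> ((nat \<Rightarrow> nat) \<Rightarrow> real) \<Rightarrow> real" where
  "TV d N k f = (\<Sum>j\<in>diff_index d N k. \<bar>total_diff d N k f j\<bar>)"

definition diff_kernel :: "nat \<Rightarrow> (nat \<Rightarrow> nat) \<Rightarrow> nat \<Rightarrow> ((nat \<Rightarrow> nat) \<Rightarrow> real) set" where
  "diff_kernel d N k = {f \<in> tensors d N. \<forall>j\<in>diff_index d N k. total_diff d N k f j = 0}"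

definition kernel_perp :: "nat \<Rightarrow> (nat \<Rightarrow> nat) \<Rightarrow> nat \<Rightarrow> ((nat \<Rightarrow> nat) \<Rightarrow> real) set" where
  "kernel_perp d N k = {f \<in> tensors d N. \<forall>h\<in>diff_kernel d N k. tensor_inner d N f h = 0}"

text \<open>
  The orthogonal projection onto \<open>kernel_perp\<close>; only the values of \<open>f\<close> on \<open>tensor_index\<close> matter.
\<close>

definition perp_proj ::
  "nat \<Rightarrow> (nat \<Rightarrow> nat) \<Rightarrow> nat \<Rightarrow> ((nat \<Rightarrow> nat) \<Rightarrow> real) \<Rightarrow> (nat \<Rightarrow> nat) \<Rightarrow> real" where
  "perp_proj d N k f =
     (THE p. p \<in> kernel_perp d N k \<and> (\<lambda>j\<in>tensor_index d N. f j - p j) \<in> diff_kernel d N k)"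

definition estimator ::
  "nat \<Rightarrow> (nat \<Rightarrow> nat) \<Rightarrow> nat \<Rightarrow> real \<Rightarrow> ((nat \<Rightarrow> nat) \<Rightarrow> real) \<Rightarrow> (nat \<Rightarrow> nat) \<Rightarrow> real" where
  "estimator d N k lam Y =
     arg_min
       (\<lambda>f. (frob_norm d N (perp_proj d N k (\<lambda>j. Y j - f j)))\<^sup>2 / real (tensor_size d N)
             + 2 * lam * TV d N k f)
       (\<lambda>f. f \<in> kernel_perp d N k)"

definition gaussian_noise ::
  "'a measure \<Rightarrow> nat \<Rightarrow> (nat \<Rightarrow> nat) \<Rightarrow> real \<Rightarrow> ((nat \<Rightarrow> nat) \<Rightarrow> 'a \<Rightarrow> real) \<Rightarrow> bool" where
  "gaussian_noise M d N \<sigma> \<epsilon> \<longleftrightarrow>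
     prob_space M \<and>
     prob_space.indep_vars M (\<lambda>_. borel) \<epsilon> (tensor_index d N) \<and>
     (\<forall>j\<in>tensor_index d N. distributed M lborel (\<epsilon> j) (\<lambda>x. ennreal (normal_density 0 \<sigma> x)))"

definition rate :: "nat \<Rightarrow> nat \<Rightarrow> nat \<Rightarrow> real" where
  "rate d k n =
     real n powr (- ((harm d + 2 * real k - 1) / (2 * harm d + 2 * real k - 1)))
     * ln (real n) powr (harm d / (2 * harm d + 2 * real k - 1))"

end

theory Submission
  imports Defs "HOL-Real_Asymp.Real_Asymp"
begin

text \<open>
  Strong convexity gives \<open>\<parallel>x - \<theta>\<parallel>\<^sup>2 \<le> \<parallel>g - \<theta>\<parallel>\<^sup>2 - \<parallel>h\<parallel>\<^sup>2 + 2\<langle>\<epsilon>, h\<rangle> + 2n\<lambda>(TV g - TV x)\<close> for the estimator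
  \<open>x\<close>, the target \<open>\<theta>\<close> and \<open>h = x - g\<close>, all in the orthogonal complement of the kernel. There, \<open>h\<close> is a
  combination, with coefficients \<open>D\<^sup>k h\<close>, of projected tensor products of truncated powers. Given a
  space \<open>V\<close> of dimension \<open>s\<close> such that all these atoms are at distance at most \<open>\<delta>\<close> from \<open>V\<close>, the noise
  term \<open>2\<langle>\<epsilon>, h\<rangle>\<close> is at most \<open>\<parallel>h\<parallel>\<^sup>2\<close> plus a chi-square variable with \<open>s\<close> degrees of freedom plus
  \<open>2 TV h\<close> times a maximum of Gaussians of order \<open>\<delta> sqrt (log n)\<close>, which \<open>n\<lambda>\<close> dominates.

  For \<open>V\<close> we take piecewise polynomials on dyadic boxes whose levels \<open>l\<close> satisfy
  \<open>\<Sum>i. H(i) l\<^sub>i \<le> log X\<close>. The weights \<open>H(1) < \<dots> < H(d)\<close> are distinct, so both \<open>s = O(X)\<close> and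
  \<open>\<delta> = O(sqrt n X powr (-(k - 1/2) / H(d)))\<close> hold without logarithmic factors; the rate results from
  taking \<open>X\<close> proportional to \<open>n\<lambda>\<close>.
\<close>

section \<open>Finite-dimensional inner products and orthogonal projections\<close>

text \<open>Minimality only compares two values of the objective; strong convexity also subtracts
  the squared distance between the two points. This is the term that pays for the noise, so the
  error of \<open>g\<close> keeps the leading constant 1. \<open>V\<close> has to serve all knots at
  once and be fixed before the noise is seen, hence blocks that do not depend on the knot. On a
  block of relative length \<open>2 powr (- l)\<close> next to its knot, a truncated power is only
  of size \<open>2 powr (- l * (k - 1))\<close>, so replacing it by zero there is cheap; the
  shortness of the block adds the 1/2 in the exponent \<open>k - 1/2\<close>. The smallest weight 1
  makes the dimension linear in \<open>X\<close>, and the largest weight \<open>H(d)\<close> governs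
  the error. Balancing dimension against error,
  \<open>sqrt (n * log n) * X powr (- (k - 1/2) / H(d)) = X\<close>, gives
  \<open>X = (n * log n) powr (H(d) / (2 * H(d) + 2 * k - 1))\<close>, which is n times the rate. A
  formal obstacle: \<open>measure\<close> is 0 on nonmeasurable sets, so the event itself must be
  shown measurable. This follows because the estimator is a Lipschitz function of the data.\<close>

definition ip :: "'b set \<Rightarrow> ('b \<Rightarrow> real) \<Rightarrow> ('b \<Rightarrow> real) \<Rightarrow> real" where
  "ip J f g = (\<Sum>x\<in>J. f x * g x)"

lemma ip_commute: "ip J f g = ip J g f"
  by (simp add: ip_def mult.commute)

lemma ip_cong: "(\<And>x. x \<in> J \<Longrightarrow> f x = f' x) \<Longrightarrow> (\<And>x. x \<in> J \<Longrightarrow> g x = g' x) \<Longrightarrow> ip J f g = ip J f' g'"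
  unfolding ip_def by (intro sum.cong) auto

lemma ip_add_left: "ip J (\<lambda>x. f x + g x) h = ip J f h + ip J g h"
  and ip_add_right: "ip J h (\<lambda>x. f x + g x) = ip J h f + ip J h g"
  and ip_diff_left: "ip J (\<lambda>x. f x - g x) h = ip J f h - ip J g h"
  and ip_diff_right: "ip J h (\<lambda>x. f x - g x) = ip J h f - ip J h g"
  and ip_scale_left: "ip J (\<lambda>x. c * f x) h = c * ip J f h"
  and ip_scale_right: "ip J h (\<lambda>x. c * f x) = c * ip J h f"
  by (simp_all add: ip_def sum.distrib sum_subtractf sum_distrib_left algebra_simps)

lemma ip_sum_left: "ip J (\<lambda>x. \<Sum>i\<in>A. f i x) h = (\<Sum>i\<in>A. ip J (f i) h)"
  and ip_sum_right: "ip J h (\<lambda>x. \<Sum>i\<in>A. f i x) = (\<Sum>i\<in>A. ip J h (f i))"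
  unfolding ip_def sum_distrib_left sum_distrib_right by (rule sum.swap)+

lemmas ip_linear = ip_add_left ip_add_right ip_diff_left ip_diff_right
  ip_scale_left ip_scale_right ip_sum_left ip_sum_right

lemma ip_self_nonneg [simp]: "0 \<le> ip J f f"
  by (simp add: ip_def sum_nonneg)

lemma ip_self_eq_0: "finite J \<Longrightarrow> ip J f f = 0 \<Longrightarrow> x \<in> J \<Longrightarrow> f x = 0"
  by (simp add: ip_def sum_nonneg_eq_0_iff)

lemma ip_zero_left: "(\<And>x. x \<in> J \<Longrightarrow> f x = 0) \<Longrightarrow> ip J f g = 0"
  by (simp add: ip_def)

lemma square_le_ip_self: "finite J \<Longrightarrow> x \<in> J \<Longrightarrow> (f x)\<^sup>2 \<le> ip J f f"
  unfolding ip_def power2_eq_square by (rule member_le_sum) auto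

lemma ip_self_diff: "ip J (\<lambda>x. f x - g x) (\<lambda>x. f x - g x) = ip J f f - 2 * ip J f g + ip J g g"
  by (simp add: ip_linear ip_commute[of J g f])

lemma two_ip_le: "2 * ip J f g \<le> ip J f f + ip J g g"
  using ip_self_nonneg[of J "\<lambda>x. f x - g x"] by (simp add: ip_self_diff)

lemma L2_set_square_eq_ip: "(L2_set f J)\<^sup>2 = ip J f f"
  by (simp add: L2_set_def ip_def sum_nonneg power2_eq_square)

lemma L2_set_sum_le:
  assumes "finite A"
  shows "L2_set (\<lambda>x. \<Sum>i\<in>A. f i x) J \<le> (\<Sum>i\<in>A. L2_set (f i) J)"
  using assms
proof (induction rule: finite_induct)
  case empty
  then show ?case by (simp add: L2_set_0')
next
  case (insert i A)
  then show ?case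
    using L2_set_triangle_ineq[of "f i" "\<lambda>x. \<Sum>i\<in>A. f i x" J] by simp
qed

text \<open>Vectors of norm zero are admitted, so that Gram-Schmidt need not discard dependent vectors.\<close>

definition orthosys :: "'b set \<Rightarrow> 'c set \<Rightarrow> ('c \<Rightarrow> 'b \<Rightarrow> real) \<Rightarrow> bool" where
  "orthosys J R e \<longleftrightarrow>
     (\<forall>r\<in>R. \<forall>q\<in>R. r \<noteq> q \<longrightarrow> ip J (e r) (e q) = 0) \<and>
     (\<forall>r\<in>R. ip J (e r) (e r) = 0 \<or> ip J (e r) (e r) = 1)"

definition oproj :: "'b set \<Rightarrow> 'c set \<Rightarrow> ('c \<Rightarrow> 'b \<Rightarrow> real) \<Rightarrow> ('b \<Rightarrow> real) \<Rightarrow> 'b \<Rightarrow> real" where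
  "oproj J R e f = (\<lambda>x. \<Sum>r\<in>R. ip J f (e r) * e r x)"

lemma oproj_cong: "(\<And>x. x \<in> J \<Longrightarrow> f x = g x) \<Longrightarrow> oproj J R e f = oproj J R e g"
  unfolding oproj_def using ip_cong[of J f g] by simp

lemma oproj_add: "oproj J R e (\<lambda>x. f x + g x) x = oproj J R e f x + oproj J R e g x"
  and oproj_diff: "oproj J R e (\<lambda>x. f x - g x) x = oproj J R e f x - oproj J R e g x"
  and oproj_scale: "oproj J R e (\<lambda>x. c * f x) x = c * oproj J R e f x"
  unfolding oproj_def ip_linear
  by (simp_all add: sum.distrib sum_subtractf sum_distrib_left algebra_simps)

lemma oproj_sum: "oproj J R e (\<lambda>x. \<Sum>i\<in>A. h i x) x = (\<Sum>i\<in>A. oproj J R e (h i) x)"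
  unfolding oproj_def ip_linear sum_distrib_right by (rule sum.swap)

lemma ip_oproj_left: "ip J (oproj J R e f) g = (\<Sum>r\<in>R. ip J f (e r) * ip J g (e r))"
  by (simp add: oproj_def ip_linear ip_commute[of J g])

lemma ip_oproj_commute: "ip J (oproj J R e f) g = ip J f (oproj J R e g)"
  by (simp add: ip_oproj_left ip_commute[of J f "oproj J R e g"] mult.commute)

context
  fixes J :: "'b set" and R :: "'c set" and e :: "'c \<Rightarrow> 'b \<Rightarrow> real"
  assumes fin: "finite J" "finite R" and os: "orthosys J R e"
begin

text \<open>A null vector of the system vanishes on \<open>J\<close>, so its coefficient is 0 as
  well and the missing normalization does no harm.\<close>

lemma ip_orthosys_self:
  assumes "q \<in> R"
  shows "ip J f (e q) * ip J (e q) (e q) = ip J f (e q)"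
proof -
  consider "ip J (e q) (e q) = 0" | "ip J (e q) (e q) = 1"
    using os assms by (auto simp: orthosys_def)
  then show ?thesis
  proof cases
    case 1
    then have "ip J (e q) f = 0"
      using ip_self_eq_0[OF fin(1) 1] by (intro ip_zero_left) auto
    then show ?thesis by (simp add: ip_commute[of J f])
  qed simp
qed

lemma ip_oproj_basis:
  assumes "q \<in> R"
  shows "ip J (oproj J R e f) (e q) = ip J f (e q)"
proof -
  have "(\<Sum>r\<in>R. ip J f (e r) * ip J (e q) (e r)) = (\<Sum>r\<in>{q}. ip J f (e r) * ip J (e q) (e r))"
    using os assms fin by (intro sum.mono_neutral_right) (auto simp: orthosys_def)
  then show ?thesis
    using ip_orthosys_self[OF assms] by (simp add: ip_oproj_left)
qed

lemma oproj_idem: "oproj J R e (oproj J R e f) = oproj J R e f"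
proof -
  have "oproj J R e (oproj J R e f) = (\<lambda>x. \<Sum>r\<in>R. ip J (oproj J R e f) (e r) * e r x)"
    by (rule oproj_def)
  also have "\<dots> = (\<lambda>x. \<Sum>r\<in>R. ip J f (e r) * e r x)"
    by (intro ext sum.cong) (simp_all add: ip_oproj_basis)
  finally show ?thesis by (simp only: oproj_def)
qed

lemma ip_oproj_self: "ip J (oproj J R e f) (oproj J R e f) = ip J (oproj J R e f) f"
  by (subst ip_oproj_commute[symmetric]) (simp add: oproj_idem)

lemma ip_oproj_residual:
  "ip J (\<lambda>x. f x - oproj J R e f x) (\<lambda>x. f x - oproj J R e f x)
   = ip J f f - ip J (oproj J R e f) (oproj J R e f)"
  by (simp add: ip_self_diff ip_oproj_self ip_commute[of J f "oproj J R e f"])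

lemma ip_oproj_le: "ip J (oproj J R e f) (oproj J R e f) \<le> ip J f f"
  using ip_self_nonneg[of J "\<lambda>x. f x - oproj J R e f x"] unfolding ip_oproj_residual by simp

text \<open>Subtracting a vector fixed by the projection does not change the residual, and a
  residual is never longer than the vector it comes from.\<close>

lemma oproj_best:
  assumes "\<And>x. x \<in> J \<Longrightarrow> oproj J R e v x = v x"
  shows "ip J (\<lambda>x. f x - oproj J R e f x) (\<lambda>x. f x - oproj J R e f x)
         \<le> ip J (\<lambda>x. f x - v x) (\<lambda>x. f x - v x)"
proof -
  let ?g = "\<lambda>x. f x - v x"
  have "ip J (\<lambda>x. f x - oproj J R e f x) (\<lambda>x. f x - oproj J R e f x)
      = ip J (\<lambda>x. ?g x - oproj J R e ?g x) (\<lambda>x. ?g x - oproj J R e ?g x)"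
    by (intro ip_cong) (simp_all add: oproj_diff assms)
  also have "\<dots> \<le> ip J ?g ?g"
    by (simp add: ip_oproj_residual)
  finally show ?thesis .
qed

end

text \<open>The third conclusion is the dual form of \<open>e r\<close> lying in the span of the
  \<open>v i\<close>. It is what later makes the projection onto the span of the difference rows
  annihilate the kernel.\<close>

lemma gram_schmidt:
  assumes J: "finite J" and R: "finite R"
  obtains e where "orthosys J R e"
    "\<And>i x. i \<in> R \<Longrightarrow> x \<in> J \<Longrightarrow> oproj J R e (v i) x = v i x"
    "\<And>w r. (\<And>i. i \<in> R \<Longrightarrow> ip J (v i) w = 0) \<Longrightarrow> r \<in> R \<Longrightarrow> ip J (e r) w = 0"
proof -
  have "\<exists>e. orthosys J R e \<and> (\<forall>i\<in>R. \<forall>x\<in>J. oproj J R e (v i) x = v i x) \<and>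
     (\<forall>w. (\<forall>i\<in>R. ip J (v i) w = 0) \<longrightarrow> (\<forall>r\<in>R. ip J (e r) w = 0))"
    using R
  proof (induction rule: finite_induct)
    case empty
    then show ?case by (simp add: orthosys_def)
  next
    case (insert i R)
    then obtain e where os: "orthosys J R e"
      and sp: "\<And>i x. i \<in> R \<Longrightarrow> x \<in> J \<Longrightarrow> oproj J R e (v i) x = v i x"
      and an: "\<And>w r. (\<forall>i\<in>R. ip J (v i) w = 0) \<Longrightarrow> r \<in> R \<Longrightarrow> ip J (e r) w = 0" by blast
    define w where "w x = v i x - oproj J R e (v i) x" for x
    \<comment> \<open>If \<open>v i\<close> depends on the earlier vectors, then
      \<open>inverse (sqrt 0) = 0\<close> turns the new member into a null vector.\<close>
    define c where "c = inverse (sqrt (ip J w w))"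
    define e' where "e' = e(i := (\<lambda>x. c * w x))"
    have e'R: "e' r = e r" if "r \<in> R" for r
      using that insert.hyps by (auto simp: e'_def)
    have e'i: "e' i = (\<lambda>x. c * w x)" by (simp add: e'_def)
    have ipw: "ip J w g = ip J (v i) g - ip J (oproj J R e (v i)) g" for g
      unfolding w_def ip_diff_left ..
    have we: "ip J w (e r) = 0" if "r \<in> R" for r
      using ip_oproj_basis[OF J insert.hyps(1) os that] by (simp add: ipw)
    have norm: "ip J (e' i) (e' i) = 0 \<or> ip J (e' i) (e' i) = 1"
    proof (cases "ip J w w = 0")
      case False
      then have "ip J w w > 0" using ip_self_nonneg[of J w] by linarith
      then show ?thesis
        by (simp add: e'i ip_linear c_def flip: real_sqrt_mult mult.assoc)
           (simp add: field_simps)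
    qed (simp add: e'i ip_linear)
    have os': "orthosys J (insert i R) e'"
      using os norm e'R we insert.hyps unfolding orthosys_def
      by (auto simp: e'i ip_linear ip_commute[of J "e _" w])
    have opr: "oproj J (insert i R) e' f x = ip J f (e' i) * e' i x + oproj J R e f x" for f x
      using insert.hyps e'R by (simp add: oproj_def)
    have ww: "ip J (v i) w = ip J w w"
    proof -
      have "ip J (oproj J R e (v i)) w = 0"
        by (simp add: ip_oproj_left we)
      then show ?thesis
        using ipw[of w] by simp
    qed
    have spi: "oproj J (insert i R) e' (v i) x = v i x" if "x \<in> J" for x
    proof (cases "ip J w w = 0")
      case True
      then have "w x = 0" using ip_self_eq_0[OF J True that] by simp
      then show ?thesis by (simp add: opr e'i) (simp add: w_def)
    next
      case False
      then have "ip J w w > 0" using ip_self_nonneg[of J w] by linarith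
      then have "ip J (v i) (e' i) * e' i x = w x"
        by (simp add: e'i ip_linear ww c_def flip: mult.assoc real_sqrt_mult)
           (simp add: field_simps)
      then show ?thesis by (simp add: opr w_def)
    qed
    have spR: "oproj J (insert i R) e' (v q) x = v q x" if "q \<in> R" "x \<in> J" for q x
    proof -
      have "ip J (v q) w = ip J (oproj J R e (v q)) w"
        by (intro ip_cong) (auto simp: sp[OF that(1)])
      also have "\<dots> = 0" by (simp add: ip_oproj_left we)
      finally show ?thesis using sp[OF that] by (simp add: opr e'i ip_linear)
    qed
    have an': "ip J (e' r) u = 0" if "\<forall>q\<in>insert i R. ip J (v q) u = 0" "r \<in> insert i R" for u r
    proof (cases "r = i")
      case True
      have "ip J u (e r) = 0" if "r \<in> R" for r
        using an[OF _ that, of u] \<open>\<forall>q\<in>insert i R. ip J (v q) u = 0\<close> by (simp add: ip_commute)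
      then have "ip J (oproj J R e (v i)) u = 0"
        by (simp add: ip_oproj_left)
      then have "ip J w u = 0"
        using that by (simp add: ipw)
      then show ?thesis by (simp add: True e'i ip_linear)
    next
      case False
      then show ?thesis using that an e'R by auto
    qed
    show ?case
      using os' spi spR an' by (intro exI[of _ e']) auto
  qed
  then show ?thesis using that by blast
qed

section \<open>Strongly convex penalized least squares\<close>

text \<open>Extensionality fixes the coordinates outside \<open>J\<close>, so convergence on
  \<open>J\<close> gives a pointwise limit everywhere. Existence matters because
  \<open>arg_min\<close> says nothing about its value unless a minimizer exists.\<close>

locale penalized_least_squares =
  fixes J :: "'b set" and K :: "('b \<Rightarrow> real) set" and pen :: "('b \<Rightarrow> real) \<Rightarrow> real"
  assumes fin: "finite J"
    and K_ext: "K \<subseteq> extensional J"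
    and K_nonempty: "K \<noteq> {}"
    and K_convex: "\<And>f g t. f \<in> K \<Longrightarrow> g \<in> K \<Longrightarrow> 0 \<le> t \<Longrightarrow> t \<le> 1 \<Longrightarrow> (\<lambda>x. (1 - t) * f x + t * g x) \<in> K"
    and K_closed: "\<And>y l. (\<And>n::nat. y n \<in> K) \<Longrightarrow> (\<And>x. (\<lambda>n. y n x) \<longlonglongrightarrow> l x) \<Longrightarrow> l \<in> K"
    and pen_nonneg: "\<And>f. 0 \<le> pen f"
    and pen_convex: "\<And>f g t. 0 \<le> t \<Longrightarrow> t \<le> 1 \<Longrightarrow>
           pen (\<lambda>x. (1 - t) * f x + t * g x) \<le> (1 - t) * pen f + t * pen g"
    and pen_continuous: "\<And>y l. (\<And>x. (\<lambda>n::nat. y n x) \<longlonglongrightarrow> l x) \<Longrightarrow> (\<lambda>n. pen (y n)) \<longlonglongrightarrow> pen l"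
begin

definition obj :: "('b \<Rightarrow> real) \<Rightarrow> ('b \<Rightarrow> real) \<Rightarrow> real" where
  "obj z f = ip J (\<lambda>x. z x - f x) (\<lambda>x. z x - f x) + pen f"

definition minimizer :: "('b \<Rightarrow> real) \<Rightarrow> ('b \<Rightarrow> real) \<Rightarrow> bool" where
  "minimizer z f \<longleftrightarrow> f \<in> K \<and> (\<forall>g\<in>K. obj z f \<le> obj z g)"

lemma obj_nonneg: "0 \<le> obj z f"
  by (simp add: obj_def pen_nonneg)

text \<open>For the squared loss this is an identity, including the defect term; the penalty only
  contributes ordinary convexity.\<close>

lemma obj_strongly_convex:
  assumes "0 \<le> t" "t \<le> 1"
  shows "obj z (\<lambda>x. (1 - t) * f x + t * g x)
         \<le> (1 - t) * obj z f + t * obj z g - t * (1 - t) * ip J (\<lambda>x. f x - g x) (\<lambda>x. f x - g x)"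
proof -
  have "(z x - ((1 - t) * f x + t * g x)) * (z x - ((1 - t) * f x + t * g x))
      = (1 - t) * ((z x - f x) * (z x - f x)) + t * ((z x - g x) * (z x - g x))
        - t * (1 - t) * ((f x - g x) * (f x - g x))" for x
    by algebra
  then have "ip J (\<lambda>x. z x - ((1 - t) * f x + t * g x)) (\<lambda>x. z x - ((1 - t) * f x + t * g x))
      = (1 - t) * ip J (\<lambda>x. z x - f x) (\<lambda>x. z x - f x) + t * ip J (\<lambda>x. z x - g x) (\<lambda>x. z x - g x)
        - t * (1 - t) * ip J (\<lambda>x. f x - g x) (\<lambda>x. f x - g x)"
    unfolding ip_def by (simp only: sum.distrib sum_subtractf sum_distrib_left)
  then show ?thesis
    using pen_convex[OF assms, of f g] by (simp add: obj_def algebra_simps)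
qed

lemma obj_continuous:
  assumes "\<And>x. (\<lambda>n::nat. y n x) \<longlonglongrightarrow> l x"
  shows "(\<lambda>n. obj z (y n)) \<longlonglongrightarrow> obj z l"
  unfolding obj_def ip_def by (intro tendsto_intros pen_continuous assms)

text \<open>By strong convexity every minimizing sequence is Cauchy.\<close>

lemma minimizer_exists: "\<exists>f. minimizer z f"
proof -
  define \<mu> where "\<mu> = Inf (obj z ` K)"
  have bdd: "bdd_below (obj z ` K)"
    by (intro bdd_belowI[of _ 0]) (auto simp: obj_nonneg)
  have \<mu>le: "\<mu> \<le> obj z f" if "f \<in> K" for f
    unfolding \<mu>_def using bdd that by (intro cInf_lower) auto
  have "\<exists>f\<in>K. obj z f < \<mu> + 1 / (real n + 1)" for n
  proof -
    have "Inf (obj z ` K) < \<mu> + 1 / (real n + 1)" by (simp add: \<mu>_def)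
    then show ?thesis
      using cInf_lessD[of "obj z ` K"] K_nonempty by auto
  qed
  then obtain y where yK: "\<And>n. y n \<in> K" and yle: "\<And>n. obj z (y n) < \<mu> + 1 / (real n + 1)"
    by metis
  \<comment> \<open>The midpoint lies in \<open>K\<close>, so its objective is at least
    \<open>\<mu>\<close>; the defect at \<open>t = 1/2\<close> is therefore bounded by the two
    excesses over \<open>\<mu>\<close>.\<close>
  have dist: "ip J (\<lambda>x. y n x - y m x) (\<lambda>x. y n x - y m x) \<le> 2 * (1 / (real n + 1) + 1 / (real m + 1))" for n m
    using obj_strongly_convex[of "1/2" z "y n" "y m"] \<mu>le[OF K_convex[OF yK[of n] yK[of m], of "1/2"]]
      yle[of n] yle[of m] by simp
  have conv: "convergent (\<lambda>n. y n x)" for x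
  proof (cases "x \<in> J")
    case False
    then have "y n x = undefined" for n
      using K_ext yK[of n] by (auto simp: extensional_def)
    then show ?thesis by (simp add: convergent_const)
  next
    case True
    have "Cauchy (\<lambda>n. y n x)"
    proof (rule metric_CauchyI)
      fix \<delta> :: real assume "\<delta> > 0"
      then obtain N :: nat where N: "4 / \<delta>\<^sup>2 < real N"
        using reals_Archimedean2 by blast
      show "\<exists>N. \<forall>m\<ge>N. \<forall>n\<ge>N. dist (y m x) (y n x) < \<delta>"
      proof (intro exI allI impI)
        fix m n assume mn: "N \<le> m" "N \<le> n"
        have "(y m x - y n x)\<^sup>2 \<le> 2 * (1 / (real m + 1) + 1 / (real n + 1))"
          using square_le_ip_self[OF fin True, of "\<lambda>x. y m x - y n x"] dist[of m n] by linarith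
        also have "\<dots> \<le> 2 * (1 / (real N + 1) + 1 / (real N + 1))"
          using mn by (intro mult_left_mono add_mono divide_left_mono) auto
        also have "\<dots> < \<delta>\<^sup>2"
          using N \<open>\<delta> > 0\<close> by (simp add: field_simps add_strict_increasing)
        finally show "dist (y m x) (y n x) < \<delta>"
          using \<open>\<delta> > 0\<close> abs_le_square_iff[of \<delta> "y m x - y n x"] by (simp add: dist_real_def not_le[symmetric])
      qed
    qed
    then show ?thesis by (rule Cauchy_convergent)
  qed
  define l where "l x = lim (\<lambda>n. y n x)" for x
  have lim: "(\<lambda>n. y n x) \<longlonglongrightarrow> l x" for x
    using conv[of x] by (simp add: l_def convergent_LIMSEQ_iff)
  have "(\<lambda>n. \<mu> + 1 / (real n + 1)) \<longlonglongrightarrow> \<mu> + 0"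
    by (intro tendsto_add tendsto_const) real_asymp
  with obj_continuous[OF lim] have "obj z l \<le> \<mu> + 0"
    by (rule LIMSEQ_le) (use yle in \<open>auto intro: less_imp_le\<close>)
  then show ?thesis
    using \<mu>le K_closed[OF yK lim] by (intro exI[of _ l]) (force simp: minimizer_def)
qed

text \<open>Compare \<open>f\<close> with the point at parameter \<open>t\<close> on the segment
  towards \<open>g\<close>, divide by \<open>t\<close> and let \<open>t\<close> tend to 0.\<close>

lemma minimizer_three_point:
  assumes f: "minimizer z f" and g: "g \<in> K"
  shows "obj z f + ip J (\<lambda>x. f x - g x) (\<lambda>x. f x - g x) \<le> obj z g"
proof -
  let ?q = "ip J (\<lambda>x. f x - g x) (\<lambda>x. f x - g x)"
  have "obj z f + (1 - t) * ?q \<le> obj z g" if "0 < t" "t < 1" for t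
  proof -
    have "obj z f \<le> obj z (\<lambda>x. (1 - t) * f x + t * g x)"
      using f g that K_convex[of f g t] by (auto simp: minimizer_def)
    also have "\<dots> \<le> (1 - t) * obj z f + t * obj z g - t * (1 - t) * ?q"
      using that by (intro obj_strongly_convex) auto
    finally have "t * (obj z f + (1 - t) * ?q) \<le> t * obj z g"
      by (simp add: algebra_simps)
    then show ?thesis using that by simp
  qed
  then have "obj z f + (1 - 1 / (real n + 2)) * ?q \<le> obj z g" for n
    by simp
  moreover have "(\<lambda>n. obj z f + (1 - 1 / (real n + 2)) * ?q) \<longlonglongrightarrow> obj z f + (1 - 0) * ?q"
    by (intro tendsto_intros) real_asymp
  ultimately show ?thesis
    using LIMSEQ_le_const2[of _ "obj z f + (1 - 0) * ?q" "obj z g"] by auto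
qed

text \<open>Adding the two three-point inequalities cancels the penalties and leaves a bilinear
  term, which is split between the two squared distances. The purpose is measurability of the
  estimator.\<close>

lemma minimizer_nonexpansive:
  assumes f: "minimizer z f" and g: "minimizer z' g"
  shows "ip J (\<lambda>x. f x - g x) (\<lambda>x. f x - g x) \<le> ip J (\<lambda>x. z x - z' x) (\<lambda>x. z x - z' x)"
proof -
  have "obj z f + ip J (\<lambda>x. f x - g x) (\<lambda>x. f x - g x) \<le> obj z g"
    using f g by (intro minimizer_three_point) (auto simp: minimizer_def)
  moreover have "obj z' g + ip J (\<lambda>x. g x - f x) (\<lambda>x. g x - f x) \<le> obj z' f"
    using f g by (intro minimizer_three_point) (auto simp: minimizer_def)
  moreover have "ip J (\<lambda>x. g x - f x) (\<lambda>x. g x - f x) = ip J (\<lambda>x. f x - g x) (\<lambda>x. f x - g x)"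
    by (simp add: ip_self_diff ip_commute[of J g f])
  moreover have "obj z g - obj z f + (obj z' f - obj z' g) = 2 * ip J (\<lambda>x. z x - z' x) (\<lambda>x. f x - g x)"
    by (simp add: obj_def ip_linear ip_commute[of J f z] ip_commute[of J g z]
        ip_commute[of J f z'] ip_commute[of J g z'])
  moreover have "2 * ip J (\<lambda>x. z x - z' x) (\<lambda>x. f x - g x)
      \<le> ip J (\<lambda>x. z x - z' x) (\<lambda>x. z x - z' x) + ip J (\<lambda>x. f x - g x) (\<lambda>x. f x - g x)"
    by (rule two_ip_le)
  ultimately show ?thesis by linarith
qed

end

text \<open>\<open>J\<close> is numbered by naturals so that \<open>G\<close> becomes a continuous
  function on a countable product, where coordinatewise measurability of the argument
  suffices.\<close>

lemma measurable_lipschitz_comp: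
  fixes G :: "('b \<Rightarrow> real) \<Rightarrow> real" and X :: "'b \<Rightarrow> 'a \<Rightarrow> real"
  assumes J: "finite J" and X: "\<And>j. j \<in> J \<Longrightarrow> X j \<in> borel_measurable M"
    and lip: "\<And>y y'. (G y - G y')\<^sup>2 \<le> ip J (\<lambda>x. y x - y' x) (\<lambda>x. y x - y' x)"
  shows "(\<lambda>\<omega>. G (\<lambda>j. X j \<omega>)) \<in> borel_measurable M"
proof -
  define num where "num = to_nat_on J"
  have inj: "inj_on num J"
    using J unfolding num_def by (intro inj_on_to_nat_on countable_finite)
  define H where "H y = G (\<lambda>j. y (num j))" for y :: "nat \<Rightarrow> real"
  have "isCont H y" for y
    unfolding isCont_def
  proof (rule Lim_null_comparison[where g = "\<lambda>y'. sqrt (\<Sum>j\<in>J. (y' (num j) - y (num j)) * (y' (num j) - y (num j)))", THEN LIM_zero_cancel])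
    show "\<forall>\<^sub>F y' in at y. norm (H y' - H y)
        \<le> sqrt (\<Sum>j\<in>J. (y' (num j) - y (num j)) * (y' (num j) - y (num j)))"
      using lip by (intro always_eventually allI) (auto simp: H_def ip_def real_le_rsqrt)
    have coord: "((\<lambda>y'. y' i) \<longlongrightarrow> y i) (at y)" for i
    proof -
      have "continuous_on UNIV (\<lambda>y'::nat \<Rightarrow> real. y' i)" by simp
      then show ?thesis by (simp add: continuous_on_def)
    qed
    have "((\<lambda>y'. sqrt (\<Sum>j\<in>J. (y' (num j) - y (num j)) * (y' (num j) - y (num j))))
        \<longlongrightarrow> sqrt (\<Sum>j\<in>J. (y (num j) - y (num j)) * (y (num j) - y (num j)))) (at y)"
      by (intro tendsto_intros coord)
    then show "((\<lambda>y'. sqrt (\<Sum>j\<in>J. (y' (num j) - y (num j)) * (y' (num j) - y (num j)))) \<longlongrightarrow> 0) (at y)"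
      by simp
  qed
  then have H: "H \<in> borel_measurable borel"
    by (intro borel_measurable_continuous_onI continuous_at_imp_continuous_on) auto
  define V where "V \<omega> i = (if i \<in> num ` J then X (inv_into J num i) \<omega> else 0)" for \<omega> i
  have V: "V \<in> borel_measurable M"
  proof (rule measurable_coordinatewise_then_product)
    fix i
    show "(\<lambda>\<omega>. V \<omega> i) \<in> borel_measurable M"
      using X[of "inv_into J num i"] inv_into_into[of i num J] by (cases "i \<in> num ` J") (auto simp: V_def)
  qed
  have "G (\<lambda>j. X j \<omega>) = H (V \<omega>)" for \<omega>
  proof -
    have "V \<omega> (num j) = X j \<omega>" if "j \<in> J" for j
      using that inj by (simp add: V_def)
    \<comment> \<open>The Lipschitz bound also shows that \<open>G\<close> ignores coordinates
      outside \<open>J\<close>: arguments at distance 0 have equal images.\<close>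
    then have "ip J (\<lambda>j. X j \<omega> - V \<omega> (num j)) (\<lambda>j. X j \<omega> - V \<omega> (num j)) = 0"
      by (intro ip_zero_left) simp
    then show ?thesis
      using lip[of "\<lambda>j. X j \<omega>" "\<lambda>j. V \<omega> (num j)"] by (simp add: H_def)
  qed
  then show ?thesis
    using measurable_compose[OF V H] by simp
qed

section \<open>Gaussian noise\<close>

lemma nn_integral_normal_density: "\<sigma> > 0 \<Longrightarrow> (\<integral>\<^sup>+x. ennreal (normal_density \<mu> \<sigma> x) \<partial>lborel) = 1"
  by (subst nn_integral_eq_integral) auto

lemma nn_integral_exp_linear_normal_density:
  assumes "\<sigma> > 0"
  shows "(\<integral>\<^sup>+x. ennreal (normal_density 0 \<sigma> x) * ennreal (exp (c * x)) \<partial>lborel)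
         = ennreal (exp (c\<^sup>2 * \<sigma>\<^sup>2 / 2))"
proof -
  have "normal_density 0 \<sigma> x * exp (c * x) = exp (c\<^sup>2 * \<sigma>\<^sup>2 / 2) * normal_density (c * \<sigma>\<^sup>2) \<sigma> x" for x
  proof -
    have "- (x - 0)\<^sup>2 / (2 * \<sigma>\<^sup>2) + c * x = c\<^sup>2 * \<sigma>\<^sup>2 / 2 + - (x - c * \<sigma>\<^sup>2)\<^sup>2 / (2 * \<sigma>\<^sup>2)"
      using assms by (simp add: field_simps power2_eq_square)
    then have "exp (- (x - 0)\<^sup>2 / (2 * \<sigma>\<^sup>2)) * exp (c * x)
        = exp (c\<^sup>2 * \<sigma>\<^sup>2 / 2) * exp (- (x - c * \<sigma>\<^sup>2)\<^sup>2 / (2 * \<sigma>\<^sup>2))"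
      by (simp only: exp_add[symmetric])
    then show ?thesis
      by (simp add: normal_density_def)
  qed
  then have "(\<integral>\<^sup>+x. ennreal (normal_density 0 \<sigma> x) * ennreal (exp (c * x)) \<partial>lborel)
      = (\<integral>\<^sup>+x. ennreal (exp (c\<^sup>2 * \<sigma>\<^sup>2 / 2)) * ennreal (normal_density (c * \<sigma>\<^sup>2) \<sigma> x) \<partial>lborel)"
    by (simp flip: ennreal_mult)
  also have "\<dots> = ennreal (exp (c\<^sup>2 * \<sigma>\<^sup>2 / 2))"
    using assms by (simp add: nn_integral_cmult nn_integral_normal_density)
  finally show ?thesis .
qed

text \<open>The tilt halves the quadratic exponent, which leaves a Gaussian of variance 2;
  \<open>sqrt 2\<close> is the ratio of the normalizing constants.\<close>

lemma nn_integral_exp_square_std_normal: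
  "(\<integral>\<^sup>+x. ennreal (std_normal_density x) * ennreal (exp (x\<^sup>2 / 4)) \<partial>lborel) = ennreal (sqrt 2)"
proof -
  have "std_normal_density x * exp (x\<^sup>2 / 4) = sqrt 2 * normal_density 0 (sqrt 2) x" for x
  proof -
    have "exp (- x\<^sup>2 / 2) * exp (x\<^sup>2 / 4) = exp (- x\<^sup>2 / 4)"
      by (simp flip: exp_add)
    then show ?thesis
      by (simp add: normal_density_def real_sqrt_mult field_simps)
  qed
  then have "(\<integral>\<^sup>+x. ennreal (std_normal_density x) * ennreal (exp (x\<^sup>2 / 4)) \<partial>lborel)
      = (\<integral>\<^sup>+x. ennreal (sqrt 2) * ennreal (normal_density 0 (sqrt 2) x) \<partial>lborel)"
    by (simp flip: ennreal_mult)
  also have "\<dots> = ennreal (sqrt 2)"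
    by (simp add: nn_integral_cmult nn_integral_normal_density)
  finally show ?thesis .
qed

lemma (in prob_space) chernoff_bound:
  fixes Y :: "'a \<Rightarrow> real"
  assumes [measurable]: "Y \<in> borel_measurable M" and "\<theta> \<ge> 0" "K \<ge> 0"
    and le: "(\<integral>\<^sup>+\<omega>. ennreal (exp (\<theta> * Y \<omega>)) \<partial>M) \<le> ennreal K"
  shows "prob {\<omega> \<in> space M. t \<le> Y \<omega>} \<le> K * exp (- \<theta> * t)"
proof -
  have "emeasure M {\<omega> \<in> space M. t \<le> Y \<omega>} = (\<integral>\<^sup>+\<omega>. indicator {\<omega> \<in> space M. t \<le> Y \<omega>} \<omega> \<partial>M)"
    by simp
  also have "\<dots> \<le> (\<integral>\<^sup>+\<omega>. ennreal (exp (- \<theta> * t)) * ennreal (exp (\<theta> * Y \<omega>)) \<partial>M)"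
  proof (intro nn_integral_mono)
    fix \<omega>
    have "1 \<le> exp (- \<theta> * t) * exp (\<theta> * Y \<omega>)" if "t \<le> Y \<omega>"
      using mult_left_mono[OF that \<open>\<theta> \<ge> 0\<close>] by (simp flip: exp_add)
    then show "indicator {\<omega> \<in> space M. t \<le> Y \<omega>} \<omega> \<le> ennreal (exp (- \<theta> * t)) * ennreal (exp (\<theta> * Y \<omega>))"
      by (auto simp: indicator_def simp flip: ennreal_mult)
  qed
  also have "\<dots> = ennreal (exp (- \<theta> * t)) * (\<integral>\<^sup>+\<omega>. ennreal (exp (\<theta> * Y \<omega>)) \<partial>M)"
    by (rule nn_integral_cmult) measurable
  also have "\<dots> \<le> ennreal (exp (- \<theta> * t)) * ennreal K"
    using le by (rule mult_left_mono) simp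
  also have "\<dots> = ennreal (K * exp (- \<theta> * t))"
    using \<open>K \<ge> 0\<close> by (simp add: mult.commute flip: ennreal_mult)
  finally show ?thesis
    using \<open>K \<ge> 0\<close> by (simp add: emeasure_eq_measure)
qed

section \<open>Tail bounds for linear and quadratic forms of a Gaussian vector\<close>

locale gaussian_vector = prob_space M for M :: "'a measure" +
  fixes J :: "'b set" and \<epsilon> :: "'b \<Rightarrow> 'a \<Rightarrow> real" and \<sigma> :: real
  assumes finite_J: "finite J" and sigma_pos: "\<sigma> > 0"
    and indep: "indep_vars (\<lambda>_. borel) \<epsilon> J"
    and normal: "\<And>j. j \<in> J \<Longrightarrow> distributed M lborel (\<epsilon> j) (\<lambda>x. ennreal (normal_density 0 \<sigma> x))"
begin

lemma noise_measurable [measurable]: "j \<in> J \<Longrightarrow> \<epsilon> j \<in> borel_measurable M"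
  using indep by (auto simp: indep_vars_def)

lemma ip_noise_measurable [measurable]: "(\<lambda>\<omega>. ip J v (\<lambda>j. \<epsilon> j \<omega>)) \<in> borel_measurable M"
  unfolding ip_def by measurable

lemma nn_integral_exp_ip:
  "(\<integral>\<^sup>+\<omega>. ennreal (exp (ip J v (\<lambda>j. \<epsilon> j \<omega>))) \<partial>M) = ennreal (exp (\<sigma>\<^sup>2 / 2 * ip J v v))"
proof -
  have "(\<integral>\<^sup>+\<omega>. ennreal (exp (ip J v (\<lambda>j. \<epsilon> j \<omega>))) \<partial>M)
      = (\<integral>\<^sup>+\<omega>. (\<Prod>j\<in>J. ennreal (exp (v j * \<epsilon> j \<omega>))) \<partial>M)"
    by (simp add: ip_def exp_sum finite_J prod_ennreal)
  also have "\<dots> = (\<Prod>j\<in>J. \<integral>\<^sup>+\<omega>. ennreal (exp (v j * \<epsilon> j \<omega>)) \<partial>M)"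
    by (intro indep_vars_nn_integral finite_J indep_vars_compose2[OF indep]) auto
  also have "\<dots> = (\<Prod>j\<in>J. ennreal (exp ((v j)\<^sup>2 * \<sigma>\<^sup>2 / 2)))"
  proof (intro prod.cong refl)
    fix j assume "j \<in> J"
    have "(\<integral>\<^sup>+\<omega>. ennreal (exp (v j * \<epsilon> j \<omega>)) \<partial>M)
        = (\<integral>\<^sup>+x. ennreal (normal_density 0 \<sigma> x) * ennreal (exp (v j * x)) \<partial>lborel)"
      by (rule distributed_nn_integral[OF normal[OF \<open>j \<in> J\<close>], symmetric]) simp
    then show "(\<integral>\<^sup>+\<omega>. ennreal (exp (v j * \<epsilon> j \<omega>)) \<partial>M) = ennreal (exp ((v j)\<^sup>2 * \<sigma>\<^sup>2 / 2))"
      using nn_integral_exp_linear_normal_density[OF sigma_pos] by simp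
  qed
  also have "\<dots> = ennreal (exp (\<sigma>\<^sup>2 / 2 * ip J v v))"
    by (simp add: prod_ennreal ip_def exp_sum[symmetric] finite_J sum_distrib_left power2_eq_square
        mult_ac)
  finally show ?thesis .
qed

lemma prob_ip_ge:
  assumes "ip J v v \<le> \<tau>\<^sup>2" "\<tau> > 0" "t \<ge> 0"
  shows "prob {\<omega> \<in> space M. t \<le> ip J v (\<lambda>j. \<epsilon> j \<omega>)} \<le> exp (- t\<^sup>2 / (2 * \<sigma>\<^sup>2 * \<tau>\<^sup>2))"
proof -
  \<comment> \<open>The minimizer of the Chernoff exponent \<open>\<sigma>\<^sup>2 *
    \<theta>\<^sup>2 * \<tau>\<^sup>2 / 2 - \<theta> * t\<close>.\<close>
  define \<theta> where "\<theta> = t / (\<sigma>\<^sup>2 * \<tau>\<^sup>2)"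
  have "(\<integral>\<^sup>+\<omega>. ennreal (exp (\<theta> * ip J v (\<lambda>j. \<epsilon> j \<omega>))) \<partial>M)
      = ennreal (exp (\<sigma>\<^sup>2 / 2 * (\<theta>\<^sup>2 * ip J v v)))"
    using nn_integral_exp_ip[of "\<lambda>x. \<theta> * v x"] by (simp add: ip_linear power2_eq_square mult_ac)
  also have "\<dots> \<le> ennreal (exp (\<sigma>\<^sup>2 / 2 * (\<theta>\<^sup>2 * \<tau>\<^sup>2)))"
    using assms by (intro ennreal_leI) (auto intro!: mult_left_mono divide_right_mono)
  finally have "prob {\<omega> \<in> space M. t \<le> ip J v (\<lambda>j. \<epsilon> j \<omega>)}
      \<le> exp (\<sigma>\<^sup>2 / 2 * (\<theta>\<^sup>2 * \<tau>\<^sup>2)) * exp (- \<theta> * t)"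
    using assms sigma_pos by (intro chernoff_bound) (auto simp: \<theta>_def)
  also have "\<dots> = exp (- t\<^sup>2 / (2 * \<sigma>\<^sup>2 * \<tau>\<^sup>2))"
    using assms sigma_pos unfolding \<theta>_def exp_add[symmetric]
    by (simp add: field_simps power2_eq_square)
  finally show ?thesis .
qed

lemma prob_abs_ip_ge:
  assumes "ip J v v \<le> \<tau>\<^sup>2" "\<tau> > 0" "t \<ge> 0"
  shows "prob {\<omega> \<in> space M. t \<le> \<bar>ip J v (\<lambda>j. \<epsilon> j \<omega>)\<bar>} \<le> 2 * exp (- t\<^sup>2 / (2 * \<sigma>\<^sup>2 * \<tau>\<^sup>2))"
proof -
  let ?w = "\<lambda>x. - 1 * v x"
  have neg: "ip J ?w g = - ip J v g" for g
    using ip_scale_left[of J "- 1" v g] by simp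
  have "ip J ?w ?w \<le> \<tau>\<^sup>2"
    using assms(1) unfolding ip_linear by simp
  then have "prob {\<omega> \<in> space M. t \<le> ip J ?w (\<lambda>j. \<epsilon> j \<omega>)} \<le> exp (- t\<^sup>2 / (2 * \<sigma>\<^sup>2 * \<tau>\<^sup>2))"
    using assms by (intro prob_ip_ge)
  moreover have "{\<omega> \<in> space M. t \<le> \<bar>ip J v (\<lambda>j. \<epsilon> j \<omega>)\<bar>}
      = {\<omega> \<in> space M. t \<le> ip J v (\<lambda>j. \<epsilon> j \<omega>)} \<union> {\<omega> \<in> space M. t \<le> ip J ?w (\<lambda>j. \<epsilon> j \<omega>)}"
    unfolding neg by auto
  moreover have "prob ({\<omega> \<in> space M. t \<le> ip J v (\<lambda>j. \<epsilon> j \<omega>)} \<union> {\<omega> \<in> space M. t \<le> ip J ?w (\<lambda>j. \<epsilon> j \<omega>)})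
      \<le> prob {\<omega> \<in> space M. t \<le> ip J v (\<lambda>j. \<epsilon> j \<omega>)} + prob {\<omega> \<in> space M. t \<le> ip J ?w (\<lambda>j. \<epsilon> j \<omega>)}"
    by (intro measure_Un_le) measurable
  ultimately show ?thesis
    using prob_ip_ge[OF assms] by simp
qed

text \<open>
  Writing \<open>exp (y\<^sup>2 / 2)\<close> as the moment generating function of an auxiliary standard Gaussian
  turns the quadratic form into a linear one, so that no rotation invariance of the noise is needed.
\<close>

lemma nn_integral_exp_chi_square:
  assumes R: "finite R" and os: "orthosys J R e"
  shows "(\<integral>\<^sup>+\<omega>. ennreal (exp (1 / (4 * \<sigma>\<^sup>2) * (\<Sum>r\<in>R. (ip J (e r) (\<lambda>j. \<epsilon> j \<omega>))\<^sup>2))) \<partial>M)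
         \<le> ennreal (sqrt 2 ^ card R)"
proof -
  define G where "G = density lborel (\<lambda>x. ennreal (std_normal_density x))"
  interpret G: prob_space G
    unfolding G_def by (rule prob_space_normal_density) simp
  interpret PG: product_sigma_finite "\<lambda>_::'c. G" ..
  interpret P: prob_space "Pi\<^sub>M R (\<lambda>_. G)"
    by (intro prob_space_PiM G.prob_space_axioms)
  interpret MP: pair_sigma_finite M "Pi\<^sub>M R (\<lambda>_. G)" ..
  have setsG [measurable_cong]: "sets G = sets borel" by (simp add: G_def)
  \<comment> \<open>With this \<open>c\<close>, integrating over the auxiliary Gaussians produces
    the exponent \<open>y\<^sup>2 / (4 * \<sigma>\<^sup>2)\<close>, while integrating over the noise
    first leaves \<open>g\<^sup>2 / 4\<close>, which is still integrable against the standard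
    Gaussian.\<close>
  define c where "c = 1 / (sqrt 2 * \<sigma>)"
  have c2: "c\<^sup>2 = 1 / (2 * \<sigma>\<^sup>2)" by (simp add: c_def power_divide power_mult_distrib)
  define y where "y r \<omega> = ip J (e r) (\<lambda>j. \<epsilon> j \<omega>)" for r \<omega>
  have [measurable]: "y r \<in> borel_measurable M" for r
    unfolding y_def by measurable
  have Gexp: "(\<integral>\<^sup>+g. ennreal (exp (a * g)) \<partial>G) = ennreal (exp (a\<^sup>2 / 2))" for a
    using nn_integral_exp_linear_normal_density[of 1 a] unfolding G_def by (subst nn_integral_density) auto
  have Gsq: "(\<integral>\<^sup>+g. ennreal (exp (g\<^sup>2 / 4)) \<partial>G) = ennreal (sqrt 2)"
    unfolding G_def by (subst nn_integral_density) (auto simp: nn_integral_exp_square_std_normal)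
  have lin: "(\<Sum>r\<in>R. c * y r \<omega> * g r) = ip J (\<lambda>x. \<Sum>r\<in>R. c * g r * e r x) (\<lambda>j. \<epsilon> j \<omega>)" for \<omega> g
    by (simp add: ip_linear y_def mult_ac)
  have nrm: "ip J (\<lambda>x. \<Sum>r\<in>R. c * g r * e r x) (\<lambda>x. \<Sum>r\<in>R. c * g r * e r x) \<le> c\<^sup>2 * (\<Sum>r\<in>R. (g r)\<^sup>2)" for g
  proof -
    have "ip J (\<lambda>x. \<Sum>r\<in>R. c * g r * e r x) (\<lambda>x. \<Sum>r\<in>R. c * g r * e r x)
        = (\<Sum>r\<in>R. \<Sum>q\<in>R. c * g r * (c * g q) * ip J (e r) (e q))"
      by (simp add: ip_linear sum_distrib_left mult_ac)
    also have "\<dots> = (\<Sum>r\<in>R. \<Sum>q\<in>{r}. c * g r * (c * g q) * ip J (e r) (e q))"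
      using os R by (intro sum.cong sum.mono_neutral_right) (auto simp: orthosys_def)
    also have "\<dots> = (\<Sum>r\<in>R. c\<^sup>2 * (g r)\<^sup>2 * ip J (e r) (e r))"
      by (simp add: power2_eq_square mult_ac)
    also have "\<dots> \<le> (\<Sum>r\<in>R. c\<^sup>2 * (g r)\<^sup>2)"
      using os by (intro sum_mono) (auto simp: orthosys_def)
    finally show ?thesis by (simp add: sum_distrib_left)
  qed
  have "(\<integral>\<^sup>+\<omega>. ennreal (exp (1 / (4 * \<sigma>\<^sup>2) * (\<Sum>r\<in>R. (y r \<omega>)\<^sup>2))) \<partial>M)
      = (\<integral>\<^sup>+\<omega>. (\<Prod>r\<in>R. \<integral>\<^sup>+g. ennreal (exp (c * y r \<omega> * g)) \<partial>G) \<partial>M)"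
    by (intro nn_integral_cong)
       (simp add: Gexp prod_ennreal power_mult_distrib c2 sum_distrib_left flip: exp_sum[OF R])
  also have "\<dots> = (\<integral>\<^sup>+\<omega>. (\<integral>\<^sup>+g. (\<Prod>r\<in>R. ennreal (exp (c * y r \<omega> * g r))) \<partial>Pi\<^sub>M R (\<lambda>_. G)) \<partial>M)"
    by (subst PG.product_nn_integral_prod) (auto simp: R)
  also have "\<dots> = (\<integral>\<^sup>+g. (\<integral>\<^sup>+\<omega>. (\<Prod>r\<in>R. ennreal (exp (c * y r \<omega> * g r))) \<partial>M) \<partial>Pi\<^sub>M R (\<lambda>_. G))"
    by (rule MP.Fubini'[symmetric]) measurable
  also have "\<dots> \<le> (\<integral>\<^sup>+g. (\<Prod>r\<in>R. ennreal (exp ((g r)\<^sup>2 / 4))) \<partial>Pi\<^sub>M R (\<lambda>_. G))"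
  proof (intro nn_integral_mono)
    fix g :: "'c \<Rightarrow> real"
    let ?v = "\<lambda>x. \<Sum>r\<in>R. c * g r * e r x"
    have "(\<integral>\<^sup>+\<omega>. (\<Prod>r\<in>R. ennreal (exp (c * y r \<omega> * g r))) \<partial>M)
        = (\<integral>\<^sup>+\<omega>. ennreal (exp (ip J ?v (\<lambda>j. \<epsilon> j \<omega>))) \<partial>M)"
      by (simp add: prod_ennreal lin flip: exp_sum[OF R])
    also have "\<dots> = ennreal (exp (\<sigma>\<^sup>2 / 2 * ip J ?v ?v))"
      by (rule nn_integral_exp_ip)
    also have "\<dots> \<le> ennreal (exp (\<sigma>\<^sup>2 / 2 * (c\<^sup>2 * (\<Sum>r\<in>R. (g r)\<^sup>2))))"
      using nrm by (intro ennreal_leI) (simp add: mult_left_mono)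
    also have "\<dots> = (\<Prod>r\<in>R. ennreal (exp ((g r)\<^sup>2 / 4)))"
    proof -
      have "\<sigma>\<^sup>2 / 2 * (c\<^sup>2 * (\<Sum>r\<in>R. (g r)\<^sup>2)) = (\<Sum>r\<in>R. (g r)\<^sup>2 / 4)"
        using sigma_pos by (simp add: c2 flip: sum_divide_distrib)
      then show ?thesis by (simp add: prod_ennreal exp_sum R)
    qed
    finally show "(\<integral>\<^sup>+\<omega>. (\<Prod>r\<in>R. ennreal (exp (c * y r \<omega> * g r))) \<partial>M) \<le> (\<Prod>r\<in>R. ennreal (exp ((g r)\<^sup>2 / 4)))" .
  qed
  also have "\<dots> = (\<Prod>r\<in>R. \<integral>\<^sup>+g. ennreal (exp (g\<^sup>2 / 4)) \<partial>G)"
    by (subst PG.product_nn_integral_prod) (auto simp: R)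
  also have "\<dots> = ennreal (sqrt 2 ^ card R)"
    by (simp add: Gsq prod_constant ennreal_power)
  finally show ?thesis by (simp add: y_def)
qed

text \<open>Chernoff at the parameter \<open>1 / (4 * \<sigma>\<^sup>2)\<close>: the share
  \<open>card R\<close> of the threshold absorbs the factor \<open>sqrt 2 ^ card R\<close>, since
  \<open>sqrt 2 \<le> exp 1\<close>, and the share \<open>t\<close> remains as the exponent.\<close>

lemma prob_chi_square_ge:
  assumes R: "finite R" and os: "orthosys J R e" and "t \<ge> 0"
  shows "prob {\<omega> \<in> space M. 4 * \<sigma>\<^sup>2 * (real (card R) + t) \<le> (\<Sum>r\<in>R. (ip J (e r) (\<lambda>j. \<epsilon> j \<omega>))\<^sup>2)}
         \<le> exp (- t)"
proof -
  let ?s = "real (card R)"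
  have "prob {\<omega> \<in> space M. 4 * \<sigma>\<^sup>2 * (?s + t) \<le> (\<Sum>r\<in>R. (ip J (e r) (\<lambda>j. \<epsilon> j \<omega>))\<^sup>2)}
      \<le> sqrt 2 ^ card R * exp (- (1 / (4 * \<sigma>\<^sup>2)) * (4 * \<sigma>\<^sup>2 * (?s + t)))"
    by (intro chernoff_bound nn_integral_exp_chi_square[OF R os]) auto
  also have "- (1 / (4 * \<sigma>\<^sup>2)) * (4 * \<sigma>\<^sup>2 * (?s + t)) = - ?s - t"
    using sigma_pos by simp
  also have "sqrt 2 ^ card R * exp (- ?s - t) \<le> exp ?s * exp (- ?s - t)"
  proof (intro mult_right_mono)
    have "sqrt 2 \<le> exp 1"
      using exp_ge_add_one_self[of 1] sqrt2_less_2 by linarith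
    then have "sqrt 2 ^ card R \<le> exp 1 ^ card R" by (intro power_mono) auto
    then show "sqrt 2 ^ card R \<le> exp ?s" by (simp flip: exp_of_nat_mult)
  qed simp
  also have "\<dots> = exp (- t)" by (simp flip: exp_add)
  finally show ?thesis by simp
qed

end

section \<open>Dyadic decomposition of truncated powers\<close>

text \<open>Defined on the integers so that shifts below 0 are genuine, whereas subtraction of
  naturals would stop at 0.\<close>

definition bdiff :: "nat \<Rightarrow> (int \<Rightarrow> real) \<Rightarrow> int \<Rightarrow> real" where
  "bdiff k F t = (\<Sum>l\<le>k. (-1) ^ l * real (k choose l) * F (t - int l))"

lemma bdiff_Suc: "bdiff (Suc k) F t = bdiff k (\<lambda>s. F s - F (s - 1)) t"
proof -
  let ?G = "\<lambda>l. F (t - int l - 1)"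
  have "bdiff (Suc k) F t = F t + (\<Sum>l\<le>k. (-1) ^ Suc l * real (Suc k choose Suc l) * F (t - int (Suc l)))"
    unfolding bdiff_def by (subst sum.atMost_Suc_shift) simp
  also have "\<dots> = F t + (\<Sum>l\<le>k. (-1) ^ Suc l * real (k choose Suc l) * ?G l)
      - (\<Sum>l\<le>k. (-1) ^ l * real (k choose l) * ?G l)"
    by (simp add: algebra_simps sum.distrib sum_subtractf sum_negf)
  also have "F t + (\<Sum>l\<le>k. (-1) ^ Suc l * real (k choose Suc l) * ?G l)
      = (\<Sum>l\<le>Suc k. (-1) ^ l * real (k choose l) * F (t - int l))"
    by (subst sum.atMost_Suc_shift) (simp add: algebra_simps)
  also have "\<dots> = (\<Sum>l\<le>k. (-1) ^ l * real (k choose l) * F (t - int l))"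
    by simp
  finally show ?thesis
    by (simp add: bdiff_def algebra_simps sum_subtractf)
qed

text \<open>By Pascal's rule each first difference lowers the degree of the truncated binomial by
  one, down to the unit step, whose difference is the unit impulse. The function is thus a discrete
  Green's function.\<close>

lemma bdiff_truncated_binomial:
  "bdiff (Suc r) (\<lambda>t. if 0 \<le> t then real ((nat t + r) choose r) else 0) t = of_bool (t = 0)"
proof (induction r)
  case 0
  show ?case by (auto simp: bdiff_def)
next
  case (Suc r)
  have "(if 0 \<le> s then real ((nat s + Suc r) choose Suc r) else 0)
      - (if 0 \<le> s - 1 then real ((nat (s - 1) + Suc r) choose Suc r) else 0)
      = (if 0 \<le> s then real ((nat s + r) choose r) else 0)" for s
  proof (cases "s \<le> 0")
    case False
    then have "nat s = Suc (nat (s - 1))" by linarith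
    then show ?thesis using False by simp
  qed auto
  then show ?case
    unfolding bdiff_Suc[of "Suc r"] using Suc by simp
qed

text \<open>The discrete counterpart of the truncated power
  \<open>((x - j) / m) ^ (k - 1) / fact (k - 1)\<close> for \<open>x\<close> to the right of
  \<open>j\<close>. Binomials instead of powers make its scaled \<open>k\<close>-th difference an
  exact unit impulse.\<close>

definition tpow :: "nat \<Rightarrow> nat \<Rightarrow> nat \<Rightarrow> nat \<Rightarrow> real" where
  "tpow m k j x = (if j \<le> x then real ((x - j + (k - 1)) choose (k - 1)) / real m ^ (k - 1) else 0)"

text \<open>The hypothesis \<open>k \<le> y\<close> keeps \<open>y - l\<close> from being cut off at
  0, which permits the transfer to the integer computation; the two powers of \<open>m\<close>
  cancel.\<close>

lemma difference_tpow:
  assumes "k \<ge> 1" "m > 0" "k \<le> y"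
  shows "real m ^ (k - 1) * (\<Sum>l=0..k. (-1) ^ l * real (k choose l) * tpow m k j (y - l)) = of_bool (y = j)"
proof -
  obtain r where k: "k = Suc r" using \<open>k \<ge> 1\<close> by (cases k) auto
  have "(\<Sum>l=0..k. (-1) ^ l * real (k choose l) * tpow m k j (y - l))
      = (\<Sum>l\<le>k. (-1) ^ l * real (k choose l) *
          (if 0 \<le> int y - int j - int l then real ((nat (int y - int j - int l) + r) choose r) else 0) / real m ^ r)"
  proof (intro sum.cong)
    fix l assume "l \<in> {..k}"
    then have "j \<le> y - l \<longleftrightarrow> 0 \<le> int y - int j - int l" "nat (int y - int j - int l) = y - l - j"
      using assms by auto
    then show "(-1) ^ l * real (k choose l) * tpow m k j (y - l) = (-1) ^ l * real (k choose l) *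
          (if 0 \<le> int y - int j - int l then real ((nat (int y - int j - int l) + r) choose r) else 0) / real m ^ r"
      by (auto simp: tpow_def k)
  qed auto
  also have "\<dots> = of_bool (int y - int j = 0) / real m ^ r"
    using bdiff_truncated_binomial[of r "int y - int j"]
    by (simp add: bdiff_def k del: sum.atMost_Suc flip: sum_divide_distrib)
  finally show ?thesis using \<open>m > 0\<close> by (simp add: k)
qed

lemma binomial_le_power_Suc: "(t + r) choose r \<le> (t + 1) ^ r"
proof (induction r)
  case (Suc r)
  have "((t + Suc r) choose Suc r) * Suc r = Suc (t + r) * ((t + r) choose r)"
    using Suc_times_binomial_eq[of "t + r" r] by simp
  also have "\<dots> \<le> ((t + 1) * Suc r) * (t + 1) ^ r"
    using Suc by (intro mult_mono) auto
  finally have "((t + Suc r) choose Suc r) * Suc r \<le> ((t + 1) ^ Suc r) * Suc r"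
    by (simp add: algebra_simps)
  then show ?case by (simp only: mult_le_cancel2)
qed simp

lemma tpow_nonneg: "0 \<le> tpow m k j x"
  by (simp add: tpow_def)

lemma tpow_le: "tpow m k j x \<le> (real (x - j + 1) / real m) ^ (k - 1)"
proof -
  have "real ((x - j + (k - 1)) choose (k - 1)) \<le> real ((x - j + 1) ^ (k - 1))"
    using binomial_le_power_Suc by (simp only: of_nat_le_iff)
  then show ?thesis
    by (auto simp: tpow_def power_divide intro!: divide_right_mono)
qed

text \<open>Vandermonde's identity: from the knot on, the truncated power is a polynomial of degree
  below \<open>k\<close>. Only its coefficients in the basis \<open>real x gchoose a\<close> depend
  on the knot; they need generalized binomials because \<open>k - 1 - j\<close> may be
  negative.\<close>

lemma tpow_gbinomial_sum:
  assumes "j \<le> x" "k \<ge> 1"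
  shows "tpow m k j x = (\<Sum>a<k. ((real k - 1 - real j) gchoose (k - 1 - a)) / real m ^ (k - 1) * (real x gchoose a))"
proof -
  have "real ((x - j + (k - 1)) choose (k - 1)) = (real x + (real k - 1 - real j)) gchoose (k - 1)"
    using assms by (simp add: binomial_gbinomial algebra_simps of_nat_diff)
  also have "\<dots> = (\<Sum>a=0..k - 1. (real x gchoose a) * ((real k - 1 - real j) gchoose (k - 1 - a)))"
    by (rule gbinomial_Vandermonde[symmetric])
  also have "{0..k - 1} = {..<k}" using assms by auto
  finally show ?thesis
    using assms by (simp add: tpow_def sum_divide_distrib mult_ac)
qed

text \<open>The index, starting from \<open>0\<close>, of the level-\<open>l\<close> dyadic subinterval of \<open>{1..m}\<close> containing \<open>x\<close>.\<close>

definition block :: "nat \<Rightarrow> nat \<Rightarrow> nat \<Rightarrow> nat" where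
  "block m l x = ((x - 1) * 2 ^ l) div m"

lemma block_mono: "x \<le> y \<Longrightarrow> block m l x \<le> block m l y"
  unfolding block_def by (intro div_le_mono mult_right_mono) auto

lemma block_Suc: "block m (Suc l) x div 2 = block m l x"
proof -
  have "block m (Suc l) x div 2 = ((x - 1) * 2 ^ l * 2) div (m * 2)"
    by (simp add: block_def div_mult2_eq mult_ac)
  then show ?thesis unfolding block_def by (simp only: div_mult_mult2)
qed

lemma block_0: "x \<in> {1..m} \<Longrightarrow> block m 0 x = 0"
  by (auto simp: block_def)

lemma block_less: "x \<in> {1..m} \<Longrightarrow> block m l x < 2 ^ l"
  by (auto simp: block_def less_mult_imp_div_less mult.commute)

lemma block_strict_mono:
  assumes "m \<le> 2 ^ l" "m > 0" "1 \<le> x" "x < y"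
  shows "block m l x < block m l y"
proof -
  have "(x - 1) * 2 ^ l + m \<le> (x - 1) * 2 ^ l + 2 ^ l" using assms by simp
  also have "\<dots> = (x - 1 + 1) * 2 ^ l" by (simp add: algebra_simps)
  also have "\<dots> \<le> (y - 1) * 2 ^ l" using assms by (intro mult_right_mono) auto
  finally have "((x - 1) * 2 ^ l + m) div m \<le> ((y - 1) * 2 ^ l) div m" by (rule div_le_mono)
  then show ?thesis using assms by (simp add: block_def)
qed

lemma block_eq_imp_close:
  assumes "block m l x = block m l y" "y < x" "1 \<le> y" "m > 0"
  shows "(x - y) * 2 ^ l < m"
proof -
  have "(x - 1) * 2 ^ l < (block m l x + 1) * m"
    using dividend_less_div_times[OF \<open>m > 0\<close>, of "(x - 1) * 2 ^ l"] by (simp add: block_def algebra_simps)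
  also have "\<dots> \<le> (y - 1) * 2 ^ l + m"
    using div_times_less_eq_dividend[of "(y - 1) * 2 ^ l" m] assms(1) by (simp add: block_def algebra_simps)
  finally have "(x - 1) * 2 ^ l < m + (y - 1) * 2 ^ l" by simp
  moreover have "(y - 1) * 2 ^ l \<le> (x - 1) * 2 ^ l"
    using assms by (intro mult_right_mono) auto
  ultimately have "(x - 1) * 2 ^ l - (y - 1) * 2 ^ l < m" by (simp add: less_diff_conv2)
  then show ?thesis using assms by (simp flip: diff_mult_distrib)
qed

text \<open>
  The part of the truncated power added when the block of the knot \<open>j\<close>, on which the power is
  replaced by zero, shrinks from level \<open>l\<close> to level \<open>l + 1\<close>.
\<close>

definition wave :: "nat \<Rightarrow> nat \<Rightarrow> nat \<Rightarrow> nat \<Rightarrow> nat \<Rightarrow> real" where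
  "wave m k j l x = tpow m k j x *
     (of_bool (block m (Suc l) (j - 1) < block m (Suc l) x) - of_bool (block m l (j - 1) < block m l x))"

text \<open>The sum telescopes. At level 0 there is only one block, and at level \<open>m\<close>
  distinct points have distinct blocks because \<open>m \<le> 2 ^ m\<close>. The comparison is with
  the block of \<open>j - 1\<close>, the last point before the power becomes nonzero; with the block
  of \<open>j\<close> the value at \<open>x = j\<close> would be lost.\<close>

lemma sum_wave:
  assumes "x \<in> {1..m}" "2 \<le> j"
  shows "(\<Sum>l<m. wave m k j l x) = tpow m k j x"
proof -
  have "(\<Sum>l<m. wave m k j l x)
      = tpow m k j x * (of_bool (block m m (j - 1) < block m m x) - of_bool (block m 0 (j - 1) < block m 0 x))"
    unfolding wave_def sum_distrib_left[symmetric]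
    using sum_lessThan_telescope[of "\<lambda>l. of_bool (block m l (j - 1) < block m l x) :: real" m] by simp
  also have "of_bool (block m 0 (j - 1) < block m 0 x) = (0 :: real)"
    using assms by (simp add: block_0)
  also have "tpow m k j x * (of_bool (block m m (j - 1) < block m m x) - 0) = tpow m k j x"
  proof (cases "j \<le> x")
    case True
    then have "block m m (j - 1) < block m m x"
      using assms less_exp[of m] by (intro block_strict_mono) auto
    then show ?thesis by simp
  qed (simp add: tpow_def)
  finally show ?thesis .
qed

text \<open>Blocks are nested, so separation from \<open>j - 1\<close> at level \<open>l\<close>
  persists at level \<open>l + 1\<close> and the two indicators cancel. A nonzero value thus forces
  \<open>x\<close> into the level-\<open>l\<close> block of \<open>j - 1\<close>.\<close>

lemma wave_support:
  assumes "wave m k j l x \<noteq> 0" "2 \<le> j" "m > 0"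
  shows "j \<le> x" "(x - j + 1) * 2 ^ l < m"
proof -
  show jx: "j \<le> x" using assms by (auto simp: wave_def tpow_def split: if_splits)
  have le: "block m l (j - 1) \<le> block m l x" using jx by (intro block_mono) auto
  have "\<not> block m l (j - 1) < block m l x"
  proof
    assume less: "block m l (j - 1) < block m l x"
    have "block m (Suc l) (j - 1) < block m (Suc l) x"
    proof (rule ccontr)
      assume "\<not> ?thesis"
      then have "block m (Suc l) x div 2 \<le> block m (Suc l) (j - 1) div 2" by (intro div_le_mono) auto
      then show False using less by (simp add: block_Suc)
    qed
    then show False using assms less by (simp add: wave_def)
  qed
  then have "(x - (j - 1)) * 2 ^ l < m"
    using le jx assms by (intro block_eq_imp_close) auto
  then show "(x - j + 1) * 2 ^ l < m" using jx assms by (simp add: Suc_diff_le)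
qed

lemma abs_wave_le:
  assumes "2 \<le> j" "m > 0"
  shows "\<bar>wave m k j l x\<bar> \<le> (1 / 2 ^ l) ^ (k - 1)"
proof (cases "wave m k j l x = 0")
  case False
  from wave_support[OF this assms] have "real ((x - j + 1) * 2 ^ l) \<le> real m" by linarith
  then have "real (x - j + 1) / real m \<le> 1 / 2 ^ l"
    using assms by (simp add: field_simps)
  then have "tpow m k j x \<le> (1 / 2 ^ l) ^ (k - 1)"
    by (intro order_trans[OF tpow_le] power_mono) auto
  moreover have "\<bar>wave m k j l x\<bar> \<le> tpow m k j x * 1"
    unfolding wave_def abs_mult by (intro mult_mono) (auto simp: tpow_nonneg)
  ultimately show ?thesis by simp
qed simp

text \<open>At most \<open>m / 2 ^ l\<close> points contribute, each at most the square of the bound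
  in \<open>abs_wave_le\<close>. The exponent \<open>2 * k - 1\<close> combines both
  factors.\<close>

lemma sum_wave_square_le:
  assumes "2 \<le> j" "m > 0" "k \<ge> 1"
  shows "(\<Sum>x\<in>{1..m}. (wave m k j l x)\<^sup>2) \<le> real m * (1 / 2 ^ l) ^ (2 * k - 1)"
proof -
  define S where "S = {j..<j + m div 2 ^ l}"
  have "(\<Sum>x\<in>{1..m}. (wave m k j l x)\<^sup>2) = (\<Sum>x\<in>{1..m} \<inter> S. (wave m k j l x)\<^sup>2)"
  proof (intro sum.mono_neutral_right ballI)
    fix x assume x: "x \<in> {1..m} - {1..m} \<inter> S"
    show "(wave m k j l x)\<^sup>2 = 0"
    proof (rule ccontr)
      assume "(wave m k j l x)\<^sup>2 \<noteq> 0"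
      then have nz: "wave m k j l x \<noteq> 0" by simp
      have "x - j + 1 \<le> m div 2 ^ l"
        using wave_support(2)[OF nz assms(1,2)] by (simp add: less_eq_div_iff_mult_less_eq)
      then show False using x wave_support(1)[OF nz assms(1,2)] by (auto simp: S_def)
    qed
  qed auto
  also have "\<dots> \<le> real (card ({1..m} \<inter> S)) * ((1 / 2 ^ l) ^ (k - 1))\<^sup>2"
    using abs_wave_le[OF assms(1,2)] by (intro sum_bounded_above) (simp add: abs_le_square_iff[symmetric])
  also have "\<dots> \<le> (real m / 2 ^ l) * ((1 / 2 ^ l) ^ (k - 1))\<^sup>2"
  proof (intro mult_right_mono)
    have "card ({1..m} \<inter> S) \<le> card S" by (intro card_mono) (auto simp: S_def)
    then have "real (card ({1..m} \<inter> S)) \<le> real (m div 2 ^ l)" by (simp add: S_def)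
    also have "\<dots> \<le> real m / real (2 ^ l)" by (rule of_nat_div_le_of_nat)
    finally show "real (card ({1..m} \<inter> S)) \<le> real m / 2 ^ l" by simp
  qed simp
  also have "\<dots> = real m * (1 / 2 ^ l) ^ (2 * k - 1)"
  proof -
    have "2 * k - 1 = Suc (2 * (k - 1))" using assms by simp
    then show ?thesis by (simp add: power_mult power2_eq_square power_divide power_mult_distrib flip: power_add mult_2)
  qed
  finally show ?thesis .
qed

text \<open>Both indicators are constant on blocks of level \<open>l + 1\<close>, since the coarser
  index is \<open>\<beta> div 2\<close>, and they vanish unless \<open>x\<close> lies to the right
  of the knot, where the power is a polynomial. The spanning functions are the same for all knots;
  only \<open>c\<close> varies.\<close>

lemma wave_in_span:
  assumes "k \<ge> 1"
  obtains c where "\<And>x. x \<in> {1..m} \<Longrightarrow> wave m k j l x =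
    (\<Sum>(\<beta>, a)\<in>{..<2 ^ Suc l} \<times> {..<k}. c (\<beta>, a) * (of_bool (block m (Suc l) x = \<beta>) * (real x gchoose a)))"
proof
  define g :: "nat \<Rightarrow> real" where
    "g \<beta> = of_bool (block m (Suc l) (j - 1) < \<beta>) - of_bool (block m l (j - 1) < \<beta> div 2)" for \<beta>
  define q where "q a = ((real k - 1 - real j) gchoose (k - 1 - a)) / real m ^ (k - 1)" for a
  define c where "c = (\<lambda>(\<beta>, a). g \<beta> * q a)"
  fix x assume x: "x \<in> {1..m}"
  have "(\<Sum>(\<beta>, a)\<in>{..<2 ^ Suc l} \<times> {..<k}. c (\<beta>, a) * (of_bool (block m (Suc l) x = \<beta>) * (real x gchoose a)))
      = (\<Sum>\<beta><2 ^ Suc l. of_bool (block m (Suc l) x = \<beta>) * (g \<beta> * (\<Sum>a<k. q a * (real x gchoose a))))"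
    by (simp add: c_def sum_distrib_left mult_ac flip: sum.cartesian_product)
  also have "\<dots> = g (block m (Suc l) x) * (\<Sum>a<k. q a * (real x gchoose a))"
    using block_less[OF x, of "Suc l"] by (simp add: of_bool_def if_distrib[of "\<lambda>u. u * _"] cong: if_cong)
  also have "\<dots> = wave m k j l x"
  proof (cases "j \<le> x")
    case True
    then show ?thesis
      using tpow_gbinomial_sum[OF True assms] by (simp add: wave_def g_def q_def block_Suc)
  next
    case False
    then have "block m (Suc l) x \<le> block m (Suc l) (j - 1)" "block m l x \<le> block m l (j - 1)"
      by (auto intro!: block_mono)
    then show ?thesis by (simp add: wave_def g_def block_Suc)
  qed
  finally show "wave m k j l x = (\<Sum>(\<beta>, a)\<in>{..<2 ^ Suc l} \<times> {..<k}. c (\<beta>, a) * (of_bool (block m (Suc l) x = \<beta>) * (real x gchoose a)))"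
    by simp
qed

section \<open>Sums over the hyperbolic cross\<close>

lemma sum_PiE_insert:
  fixes F :: "('i \<Rightarrow> 'c) \<Rightarrow> real"
  assumes "i \<notin> K"
  shows "(\<Sum>l\<in>PiE (insert i K) B. F l) = (\<Sum>g\<in>PiE K B. \<Sum>y\<in>B i. F (g(i := y)))"
proof -
  have "(\<Sum>l\<in>PiE (insert i K) B. F l) = (\<Sum>(y, g)\<in>B i \<times> PiE K B. F (g(i := y)))"
    unfolding PiE_insert_eq using inj_combinator[OF assms, of B]
    by (subst sum.reindex) (auto simp: case_prod_unfold)
  also have "\<dots> = (\<Sum>g\<in>PiE K B. \<Sum>y\<in>B i. F (g(i := y)))"
    by (simp only: sum.cartesian_product[symmetric] sum.swap[of _ "B i"])
  finally show ?thesis .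
qed

lemma prod_fun_upd_insert:
  fixes F :: "'i \<Rightarrow> 'c \<Rightarrow> real"
  assumes "finite K" "i \<notin> K"
  shows "(\<Prod>q\<in>insert i K. F q ((g(i := y)) q)) = F i y * (\<Prod>q\<in>K. F q (g q))"
proof -
  have "(\<Prod>q\<in>K. F q ((g(i := y)) q)) = (\<Prod>q\<in>K. F q (g q))"
    using assms by (intro prod.cong) auto
  then show ?thesis using assms by simp
qed

lemma geometric_partial_sum_le:
  fixes r :: real
  assumes "0 \<le> r" "r < 1"
  shows "(\<Sum>i<n. r ^ i) \<le> 1 / (1 - r)"
  using assms by (simp add: sum_gp_strict divide_right_mono)

lemma sum_PiE_geometric_le:
  fixes r :: "'i \<Rightarrow> real"
  assumes "finite K" "\<And>i. i \<in> K \<Longrightarrow> 0 \<le> r i" "\<And>i. i \<in> K \<Longrightarrow> r i < 1"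
  shows "(\<Sum>g\<in>PiE K (\<lambda>_. {..<n}). \<Prod>i\<in>K. r i ^ g i) \<le> (\<Prod>i\<in>K. 1 / (1 - r i))"
proof -
  have "(\<Sum>g\<in>PiE K (\<lambda>_. {..<n}). \<Prod>i\<in>K. r i ^ g i) = (\<Prod>i\<in>K. \<Sum>y<n. r i ^ y)"
    using assms by (intro prod_sum_PiE[symmetric]) auto
  also have "\<dots> \<le> (\<Prod>i\<in>K. 1 / (1 - r i))"
    using assms by (intro prod_mono conjI sum_nonneg geometric_partial_sum_le) auto
  finally show ?thesis .
qed

lemma sum_power2_le_bounded:
  fixes Y :: real
  assumes "0 \<le> Y"
  shows "(\<Sum>y<n. if 2 ^ y \<le> Y then 2 ^ y else 0) \<le> 2 * Y"
proof (induction n)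
  case (Suc n)
  show ?case
  proof (cases "2 ^ n \<le> Y")
    case True
    have "(\<Sum>y<Suc n. if 2 ^ y \<le> Y then 2 ^ y else 0) \<le> (\<Sum>y<Suc n. (2 :: real) ^ y)"
      by (intro sum_mono) auto
    also have "\<dots> = 2 ^ Suc n - 1" by (subst sum_gp_strict) simp
    also have "\<dots> \<le> 2 * Y" using True by simp
    finally show ?thesis .
  qed (use Suc in simp)
qed (use assms in simp)

text \<open>A geometric tail is comparable to its first term, and the threshold crossed at that term
  turns it into a power of \<open>Z\<close>.\<close>

lemma sum_powr_tail_le:
  fixes Z W \<kappa> :: real
  assumes "Z > 0" "W > 0" "\<kappa> > 0"
  shows "(\<Sum>y<n. if Z < 2 powr (W * real y) then 2 powr (- \<kappa> * real y) else 0)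
         \<le> Z powr (- \<kappa> / W) / (1 - 2 powr (- \<kappa>))"
proof (cases "\<exists>y::nat. Z < 2 powr (W * real y)")
  case True
  define y0 where "y0 = (LEAST y::nat. Z < 2 powr (W * real y))"
  define r where "r = 2 powr (- \<kappa>)"
  have r: "0 < r" "r < 1" using assms by (simp_all add: r_def powr_less_one)
  have ry: "2 powr (- \<kappa> * real y) = r ^ y" for y by (simp add: r_def powr_power mult.commute)
  have y0: "Z < 2 powr (W * real y0)" using True unfolding y0_def by (rule LeastI_ex)
  have "(\<Sum>y<n. if Z < 2 powr (W * real y) then r ^ y else 0) \<le> (\<Sum>y<y0 + n. if y0 \<le> y then r ^ y else 0)"
  proof (rule order_trans[OF sum_mono2[of "{..<y0 + n}"] sum_mono])
    fix y
    show "(if Z < 2 powr (W * real y) then r ^ y else 0) \<le> (if y0 \<le> y then r ^ y else 0)"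
      using r Least_le[of "\<lambda>y. Z < 2 powr (W * real y)" y] by (auto simp: y0_def)
  qed (use r in auto)
  also have "\<dots> = (\<Sum>y=y0..<y0 + n. r ^ y)"
    by (simp add: sum.If_cases lessThan_atLeast0 Int_def) (intro sum.cong, auto)
  also have "\<dots> = r ^ y0 * (\<Sum>i<n. r ^ i)"
    using sum.shift_bounds_nat_ivl[of "\<lambda>y. r ^ y" 0 y0 n]
    by (simp add: sum_distrib_left power_add lessThan_atLeast0 add.commute mult.commute)
  also have "\<dots> \<le> Z powr (- \<kappa> / W) * (1 / (1 - r))"
  proof (intro mult_mono geometric_partial_sum_le)
    have "r ^ y0 = (2 powr (W * real y0)) powr (- \<kappa> / W)"
      using assms by (simp add: powr_powr mult.commute flip: ry)
    also have "\<dots> \<le> Z powr (- \<kappa> / W)"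
      using assms y0 by (intro powr_mono2') auto
    finally show "r ^ y0 \<le> Z powr (- \<kappa> / W)" .
  qed (use r in \<open>auto intro!: sum_nonneg\<close>)
  finally show ?thesis unfolding ry by (simp add: r_def)
next
  case False
  have "2 powr (- \<kappa>) < 1" using assms by (simp add: powr_less_one)
  then show ?thesis using False by simp
qed

text \<open>
  With distinct weights only one coordinate is critical in each of the following two sums, and the
  geometric series in the other coordinates converge; hence no logarithmic factors appear.
\<close>

lemma hyperbolic_cross_count:
  fixes w :: "'i \<Rightarrow> real" and X :: real
  assumes K: "finite K" "i0 \<notin> K" and w: "w i0 = 1" "\<And>i. i \<in> K \<Longrightarrow> 1 < w i" and X: "X > 0"
  shows "(\<Sum>l\<in>PiE (insert i0 K) (\<lambda>_. {..<n}).
            if (\<Prod>i\<in>insert i0 K. 2 powr (w i * real (l i))) \<le> X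
            then (\<Prod>i\<in>insert i0 K. 2 ^ l i) else (0 :: real))
         \<le> 2 * X * (\<Prod>i\<in>K. 1 / (1 - 2 powr (1 - w i)))"
proof -
  define Q where "Q g = (\<Prod>i\<in>K. 2 powr (w i * real (g i)))" for g
  have Qpos: "Q g > 0" for g unfolding Q_def by (intro prod_pos) auto
  have "(\<Sum>l\<in>PiE (insert i0 K) (\<lambda>_. {..<n}).
            if (\<Prod>i\<in>insert i0 K. 2 powr (w i * real (l i))) \<le> X
            then (\<Prod>i\<in>insert i0 K. 2 ^ l i) else (0 :: real))
      = (\<Sum>g\<in>PiE K (\<lambda>_. {..<n}). \<Sum>y<n. if 2 ^ y * Q g \<le> X then 2 ^ y * (\<Prod>i\<in>K. 2 ^ g i) else 0)"
    unfolding sum_PiE_insert[OF K(2)]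
      prod_fun_upd_insert[OF K, of "\<lambda>i y. 2 powr (w i * real y)"]
      prod_fun_upd_insert[OF K, of "\<lambda>i y. 2 ^ y"]
    by (simp add: w(1) powr_realpow Q_def)
  also have "\<dots> = (\<Sum>g\<in>PiE K (\<lambda>_. {..<n}). (\<Prod>i\<in>K. 2 ^ g i) * (\<Sum>y<n. if 2 ^ y \<le> X / Q g then 2 ^ y else 0))"
    using Qpos unfolding sum_distrib_left by (intro sum.cong refl) (auto simp: field_simps)
  \<comment> \<open>The critical coordinate is the one of smallest weight. Summing it out leaves the
    ratios \<open>2 powr (1 - w i)\<close>, which are below 1 for the heavier coordinates.\<close>
  also have "\<dots> \<le> (\<Sum>g\<in>PiE K (\<lambda>_. {..<n}). (\<Prod>i\<in>K. 2 ^ g i) * (2 * (X / Q g)))"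
    using X Qpos by (intro sum_mono mult_left_mono sum_power2_le_bounded prod_nonneg) (auto simp: less_imp_le)
  also have "\<dots> = 2 * X * (\<Sum>g\<in>PiE K (\<lambda>_. {..<n}). \<Prod>i\<in>K. (2 powr (1 - w i)) ^ g i)"
  proof -
    have "(\<Prod>i\<in>K. 2 ^ g i) / Q g = (\<Prod>i\<in>K. (2 powr (1 - w i)) ^ g i)" for g
      unfolding Q_def prod_dividef[symmetric]
    proof (intro prod.cong refl)
      fix i
      have "(2 powr (1 - w i)) ^ g i = 2 powr (real (g i) - w i * real (g i))"
        by (simp add: powr_power algebra_simps)
      then show "2 ^ g i / 2 powr (w i * real (g i)) = (2 powr (1 - w i)) ^ g i"
        by (simp add: powr_diff powr_realpow)
    qed
    then show ?thesis
      by (simp add: sum_distrib_left mult_ac flip: times_divide_eq_right)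
  qed
  also have "\<dots> \<le> 2 * X * (\<Prod>i\<in>K. 1 / (1 - 2 powr (1 - w i)))"
    using X K w by (intro mult_left_mono sum_PiE_geometric_le) (auto simp: powr_less_one)
  finally show ?thesis .
qed

lemma hyperbolic_cross_tail:
  fixes w :: "'i \<Rightarrow> real" and X \<kappa> :: real
  assumes K: "finite K" "i0 \<notin> K" and w: "w i0 > 0" "\<And>i. i \<in> K \<Longrightarrow> w i < w i0" and X: "X > 0" and \<kappa>: "\<kappa> > 0"
  shows "(\<Sum>l\<in>PiE (insert i0 K) (\<lambda>_. {..<n}).
            if X < (\<Prod>i\<in>insert i0 K. 2 powr (w i * real (l i)))
            then (\<Prod>i\<in>insert i0 K. 2 powr (- \<kappa> * real (l i))) else 0)
         \<le> X powr (- \<kappa> / w i0) / (1 - 2 powr (- \<kappa>)) * (\<Prod>i\<in>K. 1 / (1 - 2 powr (- \<kappa> * (1 - w i / w i0))))"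
proof -
  let ?W = "w i0"
  define Q where "Q g = (\<Prod>i\<in>K. 2 powr (w i * real (g i)))" for g
  define V :: "('i \<Rightarrow> nat) \<Rightarrow> real" where "V g = (\<Prod>i\<in>K. 2 powr (- \<kappa> * real (g i)))" for g
  have Qpos: "Q g > 0" for g unfolding Q_def by (intro prod_pos) auto
  have Vpos: "V g > 0" for g unfolding V_def by (intro prod_pos) auto
  have "(\<Sum>l\<in>PiE (insert i0 K) (\<lambda>_. {..<n}).
            if X < (\<Prod>i\<in>insert i0 K. 2 powr (w i * real (l i)))
            then (\<Prod>i\<in>insert i0 K. 2 powr (- \<kappa> * real (l i))) else 0)
      = (\<Sum>g\<in>PiE K (\<lambda>_. {..<n}). \<Sum>y<n. if X < 2 powr (?W * real y) * Q g then 2 powr (- \<kappa> * real y) * V g else 0)"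
    unfolding sum_PiE_insert[OF K(2)]
      prod_fun_upd_insert[OF K, of "\<lambda>i y. 2 powr (w i * real y)"]
      prod_fun_upd_insert[OF K, of "\<lambda>i y. 2 powr (- \<kappa> * real y)"]
    by (simp add: Q_def V_def cong: if_cong)
  also have "\<dots> = (\<Sum>g\<in>PiE K (\<lambda>_. {..<n}). V g * (\<Sum>y<n. if X / Q g < 2 powr (?W * real y) then 2 powr (- \<kappa> * real y) else 0))"
    using Qpos unfolding sum_distrib_left by (intro sum.cong refl) (auto simp: pos_divide_less_eq)
  \<comment> \<open>Here the critical coordinate is the one of largest weight; what remains are
    ratios that are below 1 because \<open>w i < w i0\<close>.\<close>
  also have "\<dots> \<le> (\<Sum>g\<in>PiE K (\<lambda>_. {..<n}). V g * ((X / Q g) powr (- \<kappa> / ?W) / (1 - 2 powr (- \<kappa>))))"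
    using X Qpos Vpos w \<kappa> by (intro sum_mono mult_left_mono sum_powr_tail_le) (auto simp: less_imp_le)
  also have "\<dots> = X powr (- \<kappa> / ?W) / (1 - 2 powr (- \<kappa>)) *
      (\<Sum>g\<in>PiE K (\<lambda>_. {..<n}). \<Prod>i\<in>K. (2 powr (- \<kappa> * (1 - w i / ?W))) ^ g i)"
  proof -
    have "V g * (X / Q g) powr (- \<kappa> / ?W) = X powr (- \<kappa> / ?W) * (\<Prod>i\<in>K. (2 powr (- \<kappa> * (1 - w i / ?W))) ^ g i)" for g
    proof -
      have "(X / Q g) powr (- \<kappa> / ?W) = X powr (- \<kappa> / ?W) * Q g powr (\<kappa> / ?W)"
        using X Qpos[of g] by (simp add: powr_divide powr_minus field_simps)
      also have "Q g powr (\<kappa> / ?W) = (\<Prod>i\<in>K. 2 powr (w i * real (g i) * (\<kappa> / ?W)))"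
        unfolding Q_def by (subst prod_powr_distrib) (auto simp: powr_powr)
      finally have "V g * (X / Q g) powr (- \<kappa> / ?W)
          = X powr (- \<kappa> / ?W) * (\<Prod>i\<in>K. 2 powr (- \<kappa> * real (g i)) * 2 powr (w i * real (g i) * (\<kappa> / ?W)))"
        by (simp add: V_def prod.distrib)
      also have "(\<Prod>i\<in>K. 2 powr (- \<kappa> * real (g i)) * 2 powr (w i * real (g i) * (\<kappa> / ?W)))
          = (\<Prod>i\<in>K. (2 powr (- \<kappa> * (1 - w i / ?W))) ^ g i)"
        by (intro prod.cong refl) (simp add: powr_power algebra_simps flip: powr_add)
      finally show ?thesis .
    qed
    then show ?thesis
      by (simp add: sum_distrib_left mult_ac)
  qed
  also have "\<dots> \<le> X powr (- \<kappa> / ?W) / (1 - 2 powr (- \<kappa>)) * (\<Prod>i\<in>K. 1 / (1 - 2 powr (- \<kappa> * (1 - w i / ?W))))"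
  proof (intro mult_left_mono sum_PiE_geometric_le)
    fix i assume "i \<in> K"
    then have "0 < \<kappa> * (1 - w i / ?W)" using w \<kappa> by (simp add: field_simps)
    then show "2 powr (- \<kappa> * (1 - w i / ?W)) < 1" by (intro powr_less_one) auto
  next
    have "2 powr (- \<kappa>) < 1" using \<kappa> by (simp add: powr_less_one)
    then show "0 \<le> X powr (- \<kappa> / ?W) / (1 - 2 powr (- \<kappa>))" by simp
  qed (use K in auto)
  finally show ?thesis .
qed

section \<open>Sparse approximation of the tensor dictionary\<close>

lemma harm_strict_mono: "i < j \<Longrightarrow> (harm i :: real) < harm j"
  by (rule strict_monoD[of harm]) (auto simp: strict_mono_Suc_iff harm_Suc)

definition tensor_tpow :: "nat \<Rightarrow> nat \<Rightarrow> nat \<Rightarrow> (nat \<Rightarrow> nat) \<Rightarrow> (nat \<Rightarrow> nat) \<Rightarrow> real" where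
  "tensor_tpow d m k j x = (\<Prod>i\<in>{1..d}. tpow m k (j i) (x i))"

definition tensor_wave :: "nat \<Rightarrow> nat \<Rightarrow> nat \<Rightarrow> (nat \<Rightarrow> nat) \<Rightarrow> (nat \<Rightarrow> nat) \<Rightarrow> (nat \<Rightarrow> nat) \<Rightarrow> real" where
  "tensor_wave d m k j l x = (\<Prod>i\<in>{1..d}. wave m k (j i) (l i) (x i))"

lemma finite_tensor_index: "finite (tensor_index d N)"
  unfolding tensor_index_def by (intro finite_PiE) auto

lemma tensor_tpow_eq_sum_wave:
  assumes x: "x \<in> tensor_index d (\<lambda>_. m)" and j: "\<And>i. i \<in> {1..d} \<Longrightarrow> 2 \<le> j i"
  shows "tensor_tpow d m k j x = (\<Sum>l\<in>PiE {1..d} (\<lambda>_. {..<m}). tensor_wave d m k j l x)"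
proof -
  have "tensor_tpow d m k j x = (\<Prod>i\<in>{1..d}. \<Sum>l<m. wave m k (j i) l (x i))"
    unfolding tensor_tpow_def
  proof (intro prod.cong refl)
    fix i assume i: "i \<in> {1..d}"
    then have "x i \<in> {1..m}" using x unfolding tensor_index_def by blast
    then show "tpow m k (j i) (x i) = (\<Sum>l<m. wave m k (j i) l (x i))"
      using sum_wave[of "x i" m "j i" k] j[OF i] by simp
  qed
  also have "\<dots> = (\<Sum>l\<in>PiE {1..d} (\<lambda>_. {..<m}). tensor_wave d m k j l x)"
    unfolding tensor_wave_def by (intro prod_sum_PiE) auto
  finally show ?thesis .
qed

lemma L2_set_tensor_wave_le:
  assumes j: "\<And>i. i \<in> {1..d} \<Longrightarrow> 2 \<le> j i" and "m > 0" "k \<ge> 1"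
  shows "L2_set (tensor_wave d m k j l) (tensor_index d (\<lambda>_. m))
         \<le> sqrt (real (m ^ d)) * (\<Prod>i\<in>{1..d}. 2 powr (- (real k - 1/2) * real (l i)))"
proof -
  let ?r = "\<lambda>i. 2 powr (- (real k - 1/2) * real (l i))"
  have "(\<Sum>x\<in>tensor_index d (\<lambda>_. m). (tensor_wave d m k j l x)\<^sup>2)
      = (\<Sum>x\<in>PiE {1..d} (\<lambda>_. {1..m}). \<Prod>i\<in>{1..d}. (wave m k (j i) (l i) (x i))\<^sup>2)"
    by (simp add: tensor_wave_def tensor_index_def prod_power_distrib)
  also have "\<dots> = (\<Prod>i\<in>{1..d}. \<Sum>x\<in>{1..m}. (wave m k (j i) (l i) x)\<^sup>2)"
    by (intro prod_sum_PiE[symmetric]) auto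
  also have "\<dots> \<le> (\<Prod>i\<in>{1..d}. real m * (?r i)\<^sup>2)"
  proof (intro prod_mono conjI sum_nonneg)
    fix i assume i: "i \<in> {1..d}"
    have "(?r i)\<^sup>2 = 2 powr (- real (l i) * real (2 * k - 1))"
      using \<open>k \<ge> 1\<close> by (simp add: power2_eq_square algebra_simps of_nat_diff flip: powr_add)
    also have "\<dots> = (2 powr (- real (l i))) ^ (2 * k - 1)"
      using \<open>k \<ge> 1\<close> by (simp add: powr_power mult.commute)
    also have "2 powr (- real (l i)) = 1 / 2 ^ l i"
      by (simp add: powr_minus powr_realpow inverse_eq_divide)
    finally show "(\<Sum>x\<in>{1..m}. (wave m k (j i) (l i) x)\<^sup>2) \<le> real m * (?r i)\<^sup>2"
      using sum_wave_square_le[OF j[OF i] assms(2,3), of "l i"] by simp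
  qed auto
  also have "\<dots> = real (m ^ d) * (\<Prod>i\<in>{1..d}. ?r i)\<^sup>2"
    by (simp add: prod.distrib prod_power_distrib)
  finally have "L2_set (tensor_wave d m k j l) (tensor_index d (\<lambda>_. m)) \<le> sqrt (real (m ^ d) * (\<Prod>i\<in>{1..d}. ?r i)\<^sup>2)"
    unfolding L2_set_def by (rule real_sqrt_le_mono)
  also have "\<dots> = sqrt (real (m ^ d)) * (\<Prod>i\<in>{1..d}. ?r i)"
    by (simp add: real_sqrt_mult prod_nonneg)
  finally show ?thesis .
qed

text \<open>A polynomial cut off to a dyadic box: \<open>l\<close> gives the levels,
  \<open>fst (\<tau> i)\<close> the interval and \<open>snd (\<tau> i)\<close> the degree in
  coordinate \<open>i\<close>. No knot occurs.\<close>

definition atom :: "nat \<Rightarrow> nat \<Rightarrow> (nat \<Rightarrow> nat) \<times> (nat \<Rightarrow> nat \<times> nat) \<Rightarrow> (nat \<Rightarrow> nat) \<Rightarrow> real" where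
  "atom d m = (\<lambda>(l, \<tau>) x. \<Prod>i\<in>{1..d}.
     of_bool (block m (Suc (l i)) (x i) = fst (\<tau> i)) * (real (x i) gchoose snd (\<tau> i)))"

definition atom_index :: "nat \<Rightarrow> nat \<Rightarrow> (nat \<Rightarrow> nat) \<Rightarrow> (nat \<Rightarrow> nat \<times> nat) set" where
  "atom_index d k l = PiE {1..d} (\<lambda>i. {..<2 ^ Suc (l i)} \<times> {..<k})"

lemma tensor_wave_in_span:
  assumes "k \<ge> 1"
  obtains c where "\<And>x. x \<in> tensor_index d (\<lambda>_. m) \<Longrightarrow>
    tensor_wave d m k j l x = (\<Sum>\<tau>\<in>atom_index d k l. c \<tau> * atom d m (l, \<tau>) x)"
proof -
  have "\<exists>c. \<forall>x\<in>{1..m}. wave m k (j i) (l i) x =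
    (\<Sum>\<tau>\<in>{..<2 ^ Suc (l i)} \<times> {..<k}. c \<tau> * (of_bool (block m (Suc (l i)) x = fst \<tau>) * (real x gchoose snd \<tau>)))" for i
    by (rule wave_in_span[OF assms, of m "j i" "l i"]) (unfold case_prod_unfold prod.collapse, blast)
  then have "\<forall>i. \<exists>c. \<forall>x\<in>{1..m}. wave m k (j i) (l i) x =
    (\<Sum>\<tau>\<in>{..<2 ^ Suc (l i)} \<times> {..<k}. c \<tau> * (of_bool (block m (Suc (l i)) x = fst \<tau>) * (real x gchoose snd \<tau>)))"
    by blast
  from choice[OF this] obtain c where c: "\<And>i x. x \<in> {1..m} \<Longrightarrow> wave m k (j i) (l i) x =
    (\<Sum>\<tau>\<in>{..<2 ^ Suc (l i)} \<times> {..<k}. c i \<tau> * (of_bool (block m (Suc (l i)) x = fst \<tau>) * (real x gchoose snd \<tau>)))"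
    by blast
  show ?thesis
  proof
    fix x assume "x \<in> tensor_index d (\<lambda>_. m)"
    then have "x i \<in> {1..m}" if "i \<in> {1..d}" for i using that unfolding tensor_index_def by blast
    then have "tensor_wave d m k j l x = (\<Prod>i\<in>{1..d}. \<Sum>\<tau>\<in>{..<2 ^ Suc (l i)} \<times> {..<k}.
        c i \<tau> * (of_bool (block m (Suc (l i)) (x i) = fst \<tau>) * (real (x i) gchoose snd \<tau>)))"
      unfolding tensor_wave_def by (intro prod.cong refl c) auto
    also have "\<dots> = (\<Sum>\<tau>\<in>atom_index d k l. \<Prod>i\<in>{1..d}.
        c i (\<tau> i) * (of_bool (block m (Suc (l i)) (x i) = fst (\<tau> i)) * (real (x i) gchoose snd (\<tau> i))))"
      unfolding atom_index_def by (intro prod_sum_PiE) auto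
    also have "\<dots> = (\<Sum>\<tau>\<in>atom_index d k l. (\<Prod>i\<in>{1..d}. c i (\<tau> i)) * atom d m (l, \<tau>) x)"
      by (simp add: atom_def prod.distrib)
    finally show "tensor_wave d m k j l x = (\<Sum>\<tau>\<in>atom_index d k l. (\<Prod>i\<in>{1..d}. c i (\<tau> i)) * atom d m (l, \<tau>) x)" .
  qed
qed

lemma card_atom_index: "card (atom_index d k l) = (2 * k) ^ d * (\<Prod>i\<in>{1..d}. 2 ^ l i)"
  by (simp add: atom_index_def card_PiE prod.distrib power_mult_distrib mult_ac)

text \<open>The levels of weight at most \<open>X\<close> span the approximating space, and the
  discarded waves are summed by the triangle inequality. \<open>\<Theta>\<close> is chosen before
  \<open>j\<close>, so the noise pays for one space only, and \<open>C1\<close>, \<open>C2\<close>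
  are chosen before \<open>m\<close> and \<open>X\<close>.\<close>

lemma tensor_tpow_approximation:
  fixes d k :: nat
  assumes d: "d \<ge> 1" and k: "k \<ge> 1"
  obtains C1 C2 :: real where "C1 > 0" "C2 > 0"
    "\<And>m X. m > 0 \<Longrightarrow> X > 0 \<Longrightarrow> \<exists>\<Theta>. finite \<Theta> \<and> real (card \<Theta>) \<le> C1 * X \<and>
       (\<forall>j. (\<forall>i\<in>{1..d}. 2 \<le> j i) \<longrightarrow> (\<exists>c.
          L2_set (\<lambda>x. tensor_tpow d m k j x - (\<Sum>\<tau>\<in>\<Theta>. c \<tau> * atom d m \<tau> x)) (tensor_index d (\<lambda>_. m))
          \<le> sqrt (real (m ^ d)) * (C2 * X powr (- (real k - 1/2) / harm d))))"
proof -
  define \<kappa> where "\<kappa> = real k - 1/2"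
  have \<kappa>: "\<kappa> > 0" using k by (simp add: \<kappa>_def)
  define C1 where "C1 = real (2 * k) ^ d * (2 * (\<Prod>i\<in>{2..d}. 1 / (1 - 2 powr (1 - harm i))))"
  define C2 where "C2 = 1 / (1 - 2 powr (- \<kappa>)) * (\<Prod>i\<in>{1..<d}. 1 / (1 - 2 powr (- \<kappa> * (1 - harm i / harm d))))"
  have harm1: "(1 :: real) < harm i" if "i \<in> {2..d}" for i
    using harm_strict_mono[of 1 i] that by (simp add: harm_expand)
  have harmd: "(harm i :: real) < harm d" if "i \<in> {1..<d}" for i
    using harm_strict_mono[of i d] that by simp
  have hd: "(harm d :: real) > 0" using d by (intro harm_pos) auto
  have C1: "C1 > 0"
    unfolding C1_def using k harm1
    by (intro mult_pos_pos prod_pos) (auto simp: powr_less_one zero_less_divide_iff)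
  have C2: "C2 > 0"
    unfolding C2_def
  proof (intro mult_pos_pos prod_pos)
    fix i assume "i \<in> {1..<d}"
    then have "0 < \<kappa> * (1 - harm i / harm d)" using harmd \<kappa> hd by simp
    then have "2 powr (- \<kappa> * (1 - harm i / harm d)) < 1" by (intro powr_less_one) auto
    then show "0 < 1 / (1 - 2 powr (- \<kappa> * (1 - harm i / harm d)))" by simp
  qed (use \<kappa> in \<open>simp add: powr_less_one\<close>)
  \<comment> \<open>Coordinate 1 has weight \<open>harm 1 = 1\<close> and is critical for the count;
    coordinate \<open>d\<close> has the largest weight and is critical for the tail.\<close>
  have ins1: "{1..d} = insert 1 {2..d}" and insd: "{1..d} = insert d {1..<d}"
    using d by auto
  show thesis
  proof (rule that[OF C1 C2])
    fix m :: nat and X :: real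
    assume m: "m > 0" and X: "X > 0"
    let ?J = "tensor_index d (\<lambda>_. m)"
    let ?P = "PiE {1..d} (\<lambda>_. {..<m})"
    have finP: "finite ?P" by (intro finite_PiE) auto
    define weight where "weight l = (\<Prod>i\<in>{1..d}. 2 powr (harm i * real (l i)))" for l :: "nat \<Rightarrow> nat"
    define I where "I = {l \<in> ?P. weight l \<le> X}"
    have finI: "finite I" using finP by (simp add: I_def)
    define \<Theta> where "\<Theta> = Sigma I (atom_index d k)"
    have fin: "finite (atom_index d k l)" for l
      unfolding atom_index_def by (intro finite_PiE) auto
    have "real (card \<Theta>) = (\<Sum>l\<in>I. real (2 * k) ^ d * (\<Prod>i\<in>{1..d}. 2 ^ l i))"
      unfolding \<Theta>_def using finI fin by (subst card_SigmaI) (auto simp: card_atom_index)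
    also have "\<dots> = real (2 * k) ^ d * (\<Sum>l\<in>?P. if weight l \<le> X then (\<Prod>i\<in>{1..d}. 2 ^ l i) else 0)"
      unfolding I_def sum_distrib_left[symmetric] by (subst sum.inter_filter[OF finP]) simp
    also have "\<dots> \<le> real (2 * k) ^ d * (2 * X * (\<Prod>i\<in>{2..d}. 1 / (1 - 2 powr (1 - harm i))))"
      unfolding weight_def ins1 using X harm1
      by (intro mult_left_mono hyperbolic_cross_count) (auto simp: harm_expand)
    also have "\<dots> = C1 * X" by (simp add: C1_def)
    finally have card: "real (card \<Theta>) \<le> C1 * X" .
    have approx: "\<exists>c. L2_set (\<lambda>x. tensor_tpow d m k j x - (\<Sum>\<tau>\<in>\<Theta>. c \<tau> * atom d m \<tau> x)) ?J
        \<le> sqrt (real (m ^ d)) * (C2 * X powr (- (real k - 1/2) / harm d))"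
      if j: "\<forall>i\<in>{1..d}. 2 \<le> j i" for j
    proof -
      have "\<exists>c. \<forall>x\<in>?J. tensor_wave d m k j l x = (\<Sum>\<tau>\<in>atom_index d k l. c \<tau> * atom d m (l, \<tau>) x)" for l
        by (rule tensor_wave_in_span[OF k, of d m j l]) blast
      then have "\<forall>l. \<exists>c. \<forall>x\<in>?J. tensor_wave d m k j l x = (\<Sum>\<tau>\<in>atom_index d k l. c \<tau> * atom d m (l, \<tau>) x)"
        by blast
      from choice[OF this] obtain c where c: "\<And>l x. x \<in> ?J \<Longrightarrow>
          tensor_wave d m k j l x = (\<Sum>\<tau>\<in>atom_index d k l. c l \<tau> * atom d m (l, \<tau>) x)"
        by blast
      define c' where "c' = (\<lambda>(l, \<tau>). c l \<tau>)"
      have "L2_set (\<lambda>x. tensor_tpow d m k j x - (\<Sum>\<tau>\<in>\<Theta>. c' \<tau> * atom d m \<tau> x)) ?J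
          = L2_set (\<lambda>x. \<Sum>l\<in>?P - I. tensor_wave d m k j l x) ?J"
      proof (intro L2_set_cong refl)
        fix x assume x: "x \<in> ?J"
        have "(\<Sum>\<tau>\<in>\<Theta>. c' \<tau> * atom d m \<tau> x) = (\<Sum>l\<in>I. \<Sum>\<tau>\<in>atom_index d k l. c l \<tau> * atom d m (l, \<tau>) x)"
          unfolding \<Theta>_def using finI fin by (subst sum.Sigma) (auto simp: c'_def case_prod_unfold)
        also have "\<dots> = (\<Sum>l\<in>I. tensor_wave d m k j l x)" by (simp add: c x)
        finally show "tensor_tpow d m k j x - (\<Sum>\<tau>\<in>\<Theta>. c' \<tau> * atom d m \<tau> x) = (\<Sum>l\<in>?P - I. tensor_wave d m k j l x)"
          using j tensor_tpow_eq_sum_wave[OF x, of j k] finP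
          by (subst sum_diff) (auto simp: I_def)
      qed
      also have "\<dots> \<le> (\<Sum>l\<in>?P - I. L2_set (tensor_wave d m k j l) ?J)"
        using finP by (intro L2_set_sum_le) auto
      also have "\<dots> \<le> (\<Sum>l\<in>?P - I. sqrt (real (m ^ d)) * (\<Prod>i\<in>{1..d}. 2 powr (- \<kappa> * real (l i))))"
        unfolding \<kappa>_def using j m k by (intro sum_mono L2_set_tensor_wave_le) auto
      also have "?P - I = {l \<in> ?P. X < weight l}" by (auto simp: I_def)
      also have "(\<Sum>l\<in>{l \<in> ?P. X < weight l}. sqrt (real (m ^ d)) * (\<Prod>i\<in>{1..d}. 2 powr (- \<kappa> * real (l i))))
          = sqrt (real (m ^ d)) * (\<Sum>l\<in>?P. if X < weight l then (\<Prod>i\<in>{1..d}. 2 powr (- \<kappa> * real (l i))) else 0)"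
        unfolding sum_distrib_left[symmetric] by (subst sum.inter_filter[OF finP]) simp
      also have "\<dots> \<le> sqrt (real (m ^ d)) * (X powr (- \<kappa> / harm d) / (1 - 2 powr (- \<kappa>)) *
          (\<Prod>i\<in>{1..<d}. 1 / (1 - 2 powr (- \<kappa> * (1 - harm i / harm d)))))"
        unfolding weight_def insd using X harmd hd \<kappa>
        by (intro mult_left_mono hyperbolic_cross_tail) auto
      also have "\<dots> = sqrt (real (m ^ d)) * (C2 * X powr (- (real k - 1/2) / harm d))"
        by (simp add: C2_def \<kappa>_def)
      finally show ?thesis by blast
    qed
    show "\<exists>\<Theta>. finite \<Theta> \<and> real (card \<Theta>) \<le> C1 * X \<and>
       (\<forall>j. (\<forall>i\<in>{1..d}. 2 \<le> j i) \<longrightarrow> (\<exists>c.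
          L2_set (\<lambda>x. tensor_tpow d m k j x - (\<Sum>\<tau>\<in>\<Theta>. c \<tau> * atom d m \<tau> x)) ?J
          \<le> sqrt (real (m ^ d)) * (C2 * X powr (- (real k - 1/2) / harm d))))"
      using card approx finI fin by (intro exI[of _ \<Theta>]) (auto simp: \<Theta>_def)
  qed
qed

section \<open>Difference operators and the oracle inequality\<close>

lemma diff_op_sum:
  "diff_op N k i (\<lambda>x. \<Sum>y\<in>S. c y * F y x) = (\<lambda>j. \<Sum>y\<in>S. c y * diff_op N k i (F y) j)"
proof
  fix j
  have "diff_op N k i (\<lambda>x. \<Sum>y\<in>S. c y * F y x) j
      = (\<Sum>l=0..k. \<Sum>y\<in>S. real (N i) ^ (k - 1) * ((-1) ^ l * real (k choose l) * (c y * F y (j(i := j i - l)))))"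
    by (simp add: diff_op_def sum_distrib_left)
  also have "\<dots> = (\<Sum>y\<in>S. \<Sum>l=0..k. real (N i) ^ (k - 1) * ((-1) ^ l * real (k choose l) * (c y * F y (j(i := j i - l)))))"
    by (rule sum.swap)
  also have "\<dots> = (\<Sum>y\<in>S. c y * diff_op N k i (F y) j)"
    by (simp add: diff_op_def sum_distrib_left mult_ac)
  finally show "diff_op N k i (\<lambda>x. \<Sum>y\<in>S. c y * F y x) j = (\<Sum>y\<in>S. c y * diff_op N k i (F y) j)" .
qed

lemma foldr_diff_op_sum:
  "foldr (diff_op N k) is (\<lambda>x. \<Sum>y\<in>S. c y * F y x) = (\<lambda>j. \<Sum>y\<in>S. c y * foldr (diff_op N k) is (F y) j)"
  by (induction "is") (simp_all add: diff_op_sum)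

text \<open>Each coordinate is shifted at most once, by at most \<open>k\<close>, from a value above
  \<open>k\<close>, so all evaluations stay inside the tensor and junk values never enter.\<close>

lemma foldr_diff_op_cong:
  assumes "\<And>x. x \<in> tensor_index d N \<Longrightarrow> f x = g x"
    and "distinct is" "set is \<subseteq> {1..d}" "j \<in> tensor_index d N" "\<And>i. i \<in> set is \<Longrightarrow> k + 1 \<le> j i"
  shows "foldr (diff_op N k) is f j = foldr (diff_op N k) is g j"
  using assms(2-)
proof (induction "is" arbitrary: j)
  case Nil
  then show ?case using assms(1) by simp
next
  case (Cons i "is")
  have "foldr (diff_op N k) is f (j(i := j i - l)) = foldr (diff_op N k) is g (j(i := j i - l))"
    if "l \<in> {0..k}" for l
  proof (rule Cons.IH)
    have "k + 1 \<le> j i" using Cons.prems(4)[of i] by simp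
    then show "j(i := j i - l) \<in> tensor_index d N"
      using Cons.prems(2,3) that unfolding tensor_index_def PiE_iff extensional_def by force
  qed (use Cons.prems in auto)
  then show ?case by (simp add: diff_op_def[of N k i])
qed

definition diff1 :: "nat \<Rightarrow> nat \<Rightarrow> (nat \<Rightarrow> real) \<Rightarrow> nat \<Rightarrow> real" where
  "diff1 m k f y = real m ^ (k - 1) * (\<Sum>l=0..k. (-1) ^ l * real (k choose l) * f (y - l))"

lemma diff_op_prod:
  assumes "finite S" "i \<in> S"
  shows "diff_op N k i (\<lambda>x. \<Prod>q\<in>S. f q (x q)) = (\<lambda>x. \<Prod>q\<in>S. (f(i := diff1 (N i) k (f i))) q (x q))"
proof
  fix j
  have "(\<Prod>q\<in>S. f q ((j(i := y)) q)) = f i y * (\<Prod>q\<in>S - {i}. f q (j q))" for y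
    using prod_fun_upd_insert[of "S - {i}" i f j y] assms by (simp add: insert_absorb)
  moreover have "(\<Prod>q\<in>S. (f(i := diff1 (N i) k (f i))) q (j q)) = diff1 (N i) k (f i) (j i) * (\<Prod>q\<in>S - {i}. f q (j q))"
    using assms by (subst prod.remove[of S i]) (auto intro!: prod.cong)
  ultimately show "diff_op N k i (\<lambda>x. \<Prod>q\<in>S. f q (x q)) j = (\<Prod>q\<in>S. (f(i := diff1 (N i) k (f i))) q (j q))"
    by (simp add: diff_op_def diff1_def sum_distrib_left sum_distrib_right mult_ac)
qed

lemma foldr_diff_op_prod:
  assumes "finite S" "distinct is" "set is \<subseteq> S"
  shows "foldr (diff_op N k) is (\<lambda>x. \<Prod>q\<in>S. f q (x q))
       = (\<lambda>x. \<Prod>q\<in>S. (if q \<in> set is then diff1 (N q) k (f q) else f q) (x q))"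
  using assms
proof (induction "is")
  case (Cons i "is")
  let ?f = "\<lambda>q. if q \<in> set is then diff1 (N q) k (f q) else f q"
  have "foldr (diff_op N k) (i # is) (\<lambda>x. \<Prod>q\<in>S. f q (x q)) = diff_op N k i (\<lambda>x. \<Prod>q\<in>S. ?f q (x q))"
    using Cons by simp
  also have "\<dots> = (\<lambda>x. \<Prod>q\<in>S. (?f(i := diff1 (N i) k (?f i))) q (x q))"
    using Cons.prems by (intro diff_op_prod) auto
  also have "?f(i := diff1 (N i) k (?f i)) = (\<lambda>q. if q \<in> set (i # is) then diff1 (N q) k (f q) else f q)"
    using Cons.prems by (auto simp: fun_eq_iff)
  finally show ?case .
qed simp

lemma diff_index_subset: "diff_index d N k \<subseteq> tensor_index d N"
  unfolding diff_index_def tensor_index_def by (intro PiE_mono) auto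

lemma finite_diff_index: "finite (diff_index d N k)"
  using finite_subset[OF diff_index_subset finite_tensor_index] .

lemma diff_index_ge: "j \<in> diff_index d N k \<Longrightarrow> i \<in> {1..d} \<Longrightarrow> k + 1 \<le> j i"
  unfolding diff_index_def by (auto dest: PiE_mem)

text \<open>Row \<open>j\<close> of the matrix of the total difference operator, read off from unit
  impulses. This turns the operator into a finite family of inner products.\<close>

definition diff_row :: "nat \<Rightarrow> (nat \<Rightarrow> nat) \<Rightarrow> nat \<Rightarrow> (nat \<Rightarrow> nat) \<Rightarrow> (nat \<Rightarrow> nat) \<Rightarrow> real" where
  "diff_row d N k j y = total_diff d N k (\<lambda>x. of_bool (x = y)) j"

lemma total_diff_eq_ip:
  assumes j: "j \<in> diff_index d N k"
  shows "total_diff d N k f j = ip (tensor_index d N) (diff_row d N k j) f"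
proof -
  have "total_diff d N k f j = total_diff d N k (\<lambda>x. \<Sum>y\<in>tensor_index d N. f y * of_bool (x = y)) j"
    unfolding total_diff_def
  proof (rule foldr_diff_op_cong)
    fix x assume "x \<in> tensor_index d N"
    then show "f x = (\<Sum>y\<in>tensor_index d N. f y * of_bool (x = y))"
      using finite_tensor_index by (simp add: of_bool_def if_distrib[of "\<lambda>u. _ * u"] cong: if_cong)
  qed (use j diff_index_subset diff_index_ge in auto)
  then show ?thesis
    by (simp add: total_diff_def diff_row_def foldr_diff_op_sum ip_def mult.commute)
qed

text \<open>The operator acts on a product factor by factor, so the one-dimensional impulses
  multiply. The truncated powers thus form a right inverse of the difference operator, and
  differences serve as dictionary coefficients.\<close>

lemma total_diff_tensor_tpow:
  assumes "k \<ge> 1" and j: "j \<in> diff_index d (\<lambda>_. m) k" and y: "y \<in> diff_index d (\<lambda>_. m) k"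
  shows "total_diff d (\<lambda>_. m) k (tensor_tpow d m k j) y = of_bool (y = j)"
proof -
  have set_upt: "set [1..<Suc d] = {1..d}" by auto
  have "total_diff d (\<lambda>_. m) k (tensor_tpow d m k j) y = (\<Prod>q\<in>{1..d}. diff1 m k (tpow m k (j q)) (y q))"
    unfolding total_diff_def tensor_tpow_def
    by (subst foldr_diff_op_prod) (auto intro!: prod.cong simp del: upt_Suc)
  also have "\<dots> = (\<Prod>q\<in>{1..d}. of_bool (y q = j q))"
  proof (intro prod.cong refl)
    fix q assume q: "q \<in> {1..d}"
    then have "k + 1 \<le> y q" "y q \<le> m" using y by (auto simp: diff_index_def dest: PiE_mem)
    then show "diff1 m k (tpow m k (j q)) (y q) = of_bool (y q = j q)"
      unfolding diff1_def using \<open>k \<ge> 1\<close> by (intro difference_tpow) auto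
  qed
  also have "\<dots> = of_bool (y = j)"
  proof (cases "y = j")
    case False
    then obtain q where "q \<in> {1..d}" "y q \<noteq> j q"
      using j y unfolding diff_index_def by (metis PiE_ext)
    then show ?thesis using False by (auto simp: prod_zero_iff)
  qed simp
  finally show ?thesis .
qed

section \<open>Kernel, orthogonal complement and total variation of an abstract analysis
  operator\<close>

locale analysis_operator =
  fixes J :: "'b set" and I :: "'c set" and a :: "'c \<Rightarrow> 'b \<Rightarrow> real"
  assumes finite_J: "finite J" and finite_I: "finite I"
begin

definition ker :: "('b \<Rightarrow> real) set" where
  "ker = {f \<in> extensional J. \<forall>j\<in>I. ip J (a j) f = 0}"

definition perp :: "('b \<Rightarrow> real) set" where
  "perp = {f \<in> extensional J. \<forall>h\<in>ker. ip J f h = 0}"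

definition tv :: "('b \<Rightarrow> real) \<Rightarrow> real" where
  "tv f = (\<Sum>j\<in>I. \<bar>ip J (a j) f\<bar>)"

text \<open>Gram-Schmidt applied to the rows, whose span is the complement of the kernel, so
  \<open>P\<close> is the projection onto that complement. Choosing the system once and for all
  makes \<open>P\<close> a constant of the locale.\<close>

definition onb :: "'c \<Rightarrow> 'b \<Rightarrow> real" where
  "onb = (SOME e. orthosys J I e \<and> (\<forall>i\<in>I. \<forall>x\<in>J. oproj J I e (a i) x = a i x) \<and>
     (\<forall>w. (\<forall>i\<in>I. ip J (a i) w = 0) \<longrightarrow> (\<forall>r\<in>I. ip J (e r) w = 0)))"

abbreviation P :: "('b \<Rightarrow> real) \<Rightarrow> 'b \<Rightarrow> real" where
  "P \<equiv> oproj J I onb"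

lemma onb: "orthosys J I onb" "i \<in> I \<Longrightarrow> x \<in> J \<Longrightarrow> P (a i) x = a i x"
  "(\<And>i. i \<in> I \<Longrightarrow> ip J (a i) w = 0) \<Longrightarrow> r \<in> I \<Longrightarrow> ip J (onb r) w = 0"
proof -
  obtain e where "orthosys J I e \<and> (\<forall>i\<in>I. \<forall>x\<in>J. oproj J I e (a i) x = a i x) \<and>
     (\<forall>w. (\<forall>i\<in>I. ip J (a i) w = 0) \<longrightarrow> (\<forall>r\<in>I. ip J (e r) w = 0))"
    by (rule gram_schmidt[OF finite_J finite_I, of a]) blast
  from someI[of "\<lambda>e. orthosys J I e \<and> (\<forall>i\<in>I. \<forall>x\<in>J. oproj J I e (a i) x = a i x) \<and>
     (\<forall>w. (\<forall>i\<in>I. ip J (a i) w = 0) \<longrightarrow> (\<forall>r\<in>I. ip J (e r) w = 0))", OF this, folded onb_def]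
  show "orthosys J I onb" "i \<in> I \<Longrightarrow> x \<in> J \<Longrightarrow> P (a i) x = a i x"
    "(\<And>i. i \<in> I \<Longrightarrow> ip J (a i) w = 0) \<Longrightarrow> r \<in> I \<Longrightarrow> ip J (onb r) w = 0" by blast+
qed

lemmas P_idem = oproj_idem[OF finite_J finite_I onb(1)]
lemmas P_norm_le = ip_oproj_le[OF finite_J finite_I onb(1)]

lemma ip_row_P: "j \<in> I \<Longrightarrow> ip J (a j) (P f) = ip J (a j) f"
  using ip_cong[of J "P (a j)" "a j" f f] by (simp add: onb(2) flip: ip_oproj_commute)

lemma tv_P: "tv (P f) = tv f"
  by (simp add: tv_def ip_row_P)

lemma tv_cong: "(\<And>x. x \<in> J \<Longrightarrow> f x = g x) \<Longrightarrow> tv f = tv g"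
  unfolding tv_def by (intro sum.cong refl arg_cong[where f = abs] ip_cong) auto

lemma tv_nonneg: "0 \<le> tv f"
  by (simp add: tv_def sum_nonneg)

lemma tv_diff_le: "tv (\<lambda>x. f x - g x) \<le> tv f + tv g"
  unfolding tv_def sum.distrib[symmetric] ip_linear by (intro sum_mono) auto

lemma tv_convex:
  assumes "0 \<le> t" "t \<le> 1"
  shows "tv (\<lambda>x. (1 - t) * f x + t * g x) \<le> (1 - t) * tv f + t * tv g"
  unfolding tv_def sum_distrib_left sum.distrib[symmetric] ip_linear
proof (intro sum_mono)
  fix j
  show "\<bar>(1 - t) * ip J (a j) f + t * ip J (a j) g\<bar> \<le> (1 - t) * \<bar>ip J (a j) f\<bar> + t * \<bar>ip J (a j) g\<bar>"
    using assms abs_triangle_ineq[of "(1 - t) * ip J (a j) f" "t * ip J (a j) g"] by (simp add: abs_mult)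
qed

lemma P_eq_0:
  assumes "\<And>j. j \<in> I \<Longrightarrow> ip J (a j) u = 0"
  shows "P u x = 0"
  using onb(3)[OF assms] by (simp add: oproj_def ip_commute[of J u])

lemma ip_P_ker: "h \<in> ker \<Longrightarrow> ip J (P f) h = 0"
  using P_eq_0[of h] by (simp add: ker_def ip_oproj_commute) (simp add: ip_def)

lemma ip_restrict_right: "ip J f (restrict g J) = ip J f g"
  by (intro ip_cong) auto

lemma residual_in_ker: "(\<lambda>x\<in>J. f x - P f x) \<in> ker"
  by (simp add: ker_def ip_restrict_right ip_diff_right ip_row_P)

text \<open>The residual \<open>f - P f\<close> lies in the kernel. If \<open>f\<close> is
  orthogonal to the kernel, then so are both \<open>f\<close> and \<open>P f\<close>, hence the
  residual is orthogonal to itself.\<close>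

lemma perp_iff: "f \<in> perp \<longleftrightarrow> f \<in> extensional J \<and> (\<forall>x\<in>J. P f x = f x)"
proof (intro iffI conjI ballI)
  assume f: "f \<in> perp"
  then show "f \<in> extensional J" by (simp add: perp_def)
  have "ip J f (\<lambda>x. f x - P f x) = 0"
    using f residual_in_ker[of f] by (force simp: perp_def ip_restrict_right)
  moreover have "ip J (P f) (\<lambda>x. f x - P f x) = 0"
    using ip_P_ker[OF residual_in_ker[of f], of f] by (simp add: ip_restrict_right)
  ultimately have "ip J (\<lambda>x. f x - P f x) (\<lambda>x. f x - P f x) = 0"
    by (simp add: ip_diff_left)
  then show "P f x = f x" if "x \<in> J" for x
    using ip_self_eq_0[OF finite_J _ that, of "\<lambda>x. f x - P f x"] by simp
next
  assume f: "f \<in> extensional J \<and> (\<forall>x\<in>J. P f x = f x)"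
  have "ip J f h = 0" if "h \<in> ker" for h
    using ip_cong[of J "P f" f h h] ip_P_ker[OF that, of f] f by simp
  then show "f \<in> perp" using f by (simp add: perp_def)
qed

lemma restrict_P_in_perp: "restrict (P f) J \<in> perp"
proof -
  have "P (restrict (P f) J) = P f"
    using oproj_cong[of J "restrict (P f) J" "P f" I onb] by (simp add: P_idem)
  then show ?thesis by (simp add: perp_iff)
qed

lemma perp_proj_eq: "(THE p. p \<in> perp \<and> (\<lambda>x\<in>J. f x - p x) \<in> ker) = restrict (P f) J"
proof (rule the_equality)
  have "(\<lambda>x\<in>J. f x - restrict (P f) J x) = (\<lambda>x\<in>J. f x - P f x)" by auto
  then show "restrict (P f) J \<in> perp \<and> (\<lambda>x\<in>J. f x - restrict (P f) J x) \<in> ker"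
    using restrict_P_in_perp residual_in_ker by simp
next
  fix p assume p: "p \<in> perp \<and> (\<lambda>x\<in>J. f x - p x) \<in> ker"
  then have pe: "p \<in> extensional J" "\<And>x. x \<in> J \<Longrightarrow> P p x = p x" by (auto simp: perp_iff)
  have "P (\<lambda>x. f x - p x) x = 0" for x
    using p by (intro P_eq_0) (auto simp: ker_def ip_restrict_right)
  then have "P f x = p x" if "x \<in> J" for x
    using pe(2)[OF that] by (simp add: oproj_diff)
  then show "p = restrict (P f) J"
    using pe(1) by (auto simp: extensional_def)
qed

lemma penalized_least_squares:
  assumes "c \<ge> 0"
  shows "penalized_least_squares J perp (\<lambda>f. c * tv f)"
proof
  show "finite J" by (rule finite_J)
  show "perp \<subseteq> extensional J" by (auto simp: perp_def)
  show "perp \<noteq> {}" using restrict_P_in_perp by blast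
  show "(\<lambda>x. (1 - t) * f x + t * g x) \<in> perp" if "f \<in> perp" "g \<in> perp" for f g and t :: real
    using that by (auto simp: perp_def extensional_def ip_linear algebra_simps)
  show "l \<in> perp" if y: "\<And>n::nat. y n \<in> perp" and lim: "\<And>x. (\<lambda>n. y n x) \<longlonglongrightarrow> l x" for y l
    unfolding perp_def
  proof (intro CollectI conjI ballI)
    show "l \<in> extensional J"
      unfolding extensional_def
    proof (intro CollectI allI impI)
      fix x assume "x \<notin> J"
      then have "(\<lambda>n. y n x) = (\<lambda>n. undefined)" using y by (auto simp: perp_def extensional_def)
      then show "l x = undefined" using LIMSEQ_unique[OF lim[of x]] by simp
    qed
    fix h assume h: "h \<in> ker"
    have "(\<lambda>n. ip J (y n) h) \<longlonglongrightarrow> ip J l h" unfolding ip_def by (intro tendsto_intros lim)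
    moreover have "ip J (y n) h = 0" for n using y[of n] h by (simp add: perp_def)
    ultimately show "ip J l h = 0" using LIMSEQ_unique[OF _ tendsto_const] by fastforce
  qed
  show "0 \<le> c * tv f" for f using assms by (simp add: tv_nonneg)
  show "c * tv (\<lambda>x. (1 - t) * f x + t * g x) \<le> (1 - t) * (c * tv f) + t * (c * tv g)"
    if "0 \<le> t" "t \<le> 1" for f g and t :: real
    using mult_left_mono[OF tv_convex[OF that, of f g] assms] by (simp add: algebra_simps)
  show "(\<lambda>n. c * tv (y n)) \<longlonglongrightarrow> c * tv l" if "\<And>x. (\<lambda>n::nat. y n x) \<longlonglongrightarrow> l x" for y l
    unfolding tv_def ip_def by (intro tendsto_intros that)
qed

text \<open>The squared distance from the three-point inequality cancels \<open>ip J h h\<close> in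
  the noise bound, and \<open>tv h \<le> tv x + tv g\<close> cancels the penalty of
  \<open>x\<close>, leaving \<open>4 * c * tv g\<close>. A general \<open>g\<close> may be replaced
  by \<open>P g\<close>: the total variation is unchanged and the distance to \<open>P f0\<close>
  does not grow.\<close>

lemma oracle_inequality:
  assumes c: "c \<ge> 0"
    and x: "penalized_least_squares.minimizer J perp (\<lambda>f. 2 * c * tv f) (P Y) x"
    and Y: "\<And>i. i \<in> J \<Longrightarrow> Y i = f0 i + E i"
    and noise: "\<And>h. (\<And>i. i \<in> J \<Longrightarrow> P h i = h i) \<Longrightarrow> 2 * ip J E h \<le> ip J h h + 2 * c * tv h + T"
  shows "ip J (\<lambda>i. x i - P f0 i) (\<lambda>i. x i - P f0 i)
         \<le> ip J (\<lambda>i. g i - P f0 i) (\<lambda>i. g i - P f0 i) + 4 * c * tv g + T"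
proof -
  interpret penalized_least_squares J perp "\<lambda>f. 2 * c * tv f"
    using c by (intro penalized_least_squares) simp
  let ?g = "restrict (P g) J"
  let ?h = "\<lambda>i. x i - P g i"
  have xp: "\<And>i. i \<in> J \<Longrightarrow> P x i = x i"
    using x by (auto simp: minimizer_def perp_iff)
  have PY: "P Y i = P f0 i + P E i" for i
    using oproj_cong[of J Y "\<lambda>i. f0 i + E i" I onb] Y by (simp add: oproj_add)
  have "obj (P Y) x + ip J (\<lambda>i. x i - ?g i) (\<lambda>i. x i - ?g i) \<le> obj (P Y) ?g"
    by (intro minimizer_three_point x restrict_P_in_perp)
  moreover have "ip J (\<lambda>i. x i - ?g i) (\<lambda>i. x i - ?g i) = ip J ?h ?h"
    by (intro ip_cong) auto
  moreover have "obj (P Y) ?g = ip J (\<lambda>i. P Y i - P g i) (\<lambda>i. P Y i - P g i) + 2 * c * tv g"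
    using tv_cong[of ?g "P g"] unfolding obj_def by (auto simp: tv_P intro!: ip_cong)
  ultimately have "ip J (\<lambda>i. P Y i - x i) (\<lambda>i. P Y i - x i) + 2 * c * tv x + ip J ?h ?h
      \<le> ip J (\<lambda>i. P Y i - P g i) (\<lambda>i. P Y i - P g i) + 2 * c * tv g"
    by (simp add: obj_def)
  moreover have "ip J (\<lambda>i. P Y i - f i) (\<lambda>i. P Y i - f i)
      = ip J (\<lambda>i. f i - P f0 i) (\<lambda>i. f i - P f0 i) - 2 * ip J (P E) f + 2 * ip J (P E) (P f0) + ip J (P E) (P E)" for f
    unfolding PY by (simp add: ip_linear ip_commute[of J f "P f0"] ip_commute[of J f "P E"]
        ip_commute[of J "P f0" "P E"] algebra_simps)
  moreover have "ip J (P E) x - ip J (P E) (P g) = ip J E ?h"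
  proof -
    have "ip J (P E) x = ip J E x"
      unfolding ip_oproj_commute using xp by (intro ip_cong) auto
    moreover have "ip J (P E) (P g) = ip J E (P g)"
      by (simp add: ip_oproj_commute P_idem)
    ultimately show ?thesis by (simp add: ip_diff_right)
  qed
  moreover have "2 * ip J E ?h \<le> ip J ?h ?h + 2 * c * tv ?h + T"
    using xp by (intro noise) (simp add: oproj_diff P_idem)
  moreover have "2 * c * tv ?h \<le> 2 * c * (tv x + tv g)"
    using tv_diff_le[of x "P g"] c by (intro mult_left_mono) (auto simp: tv_P)
  moreover have "ip J (\<lambda>i. P g i - P f0 i) (\<lambda>i. P g i - P f0 i) \<le> ip J (\<lambda>i. g i - P f0 i) (\<lambda>i. g i - P f0 i)"
  proof -
    have "P (\<lambda>i. g i - P f0 i) = (\<lambda>i. P g i - P f0 i)" by (simp add: fun_eq_iff oproj_diff P_idem)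
    then show ?thesis using P_norm_le[of "\<lambda>i. g i - P f0 i"] by simp
  qed
  ultimately show ?thesis by (simp add: algebra_simps)
qed

text \<open>
  The noise acts on \<open>h\<close> through its component in the span of the approximants, which costs the
  degrees of freedom, and through the residuals of the dictionary atoms, which the penalty absorbs.
\<close>

lemma noise_decomposition:
  assumes dict: "\<And>i j. i \<in> I \<Longrightarrow> j \<in> I \<Longrightarrow> ip J (a i) (\<phi> j) = of_bool (i = j)"
    and \<Theta>: "finite \<Theta>"
    and appr: "\<And>j. j \<in> I \<Longrightarrow> \<exists>c. L2_set (\<lambda>x. \<phi> j x - (\<Sum>\<tau>\<in>\<Theta>. c \<tau> * v \<tau> x)) J \<le> \<delta>"
  shows "\<exists>e \<rho>. orthosys J \<Theta> e \<and> (\<forall>j\<in>I. ip J (\<rho> j) (\<rho> j) \<le> \<delta>\<^sup>2) \<and>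
    (\<forall>E h t. (\<forall>i\<in>J. P h i = h i) \<longrightarrow> (\<forall>j\<in>I. \<bar>ip J (\<rho> j) E\<bar> \<le> t) \<longrightarrow>
       2 * ip J E h \<le> ip J h h + 2 * t * tv h + (\<Sum>\<tau>\<in>\<Theta>. (ip J (e \<tau>) E)\<^sup>2))"
proof -
  \<comment> \<open>The approximants are projected first: \<open>P\<close> is linear and does not
    increase distances, so they approximate the projected dictionary equally well.\<close>
  obtain e where os: "orthosys J \<Theta> e"
    and span: "\<And>\<tau> x. \<tau> \<in> \<Theta> \<Longrightarrow> x \<in> J \<Longrightarrow> oproj J \<Theta> e (P (v \<tau>)) x = P (v \<tau>) x"
    using gram_schmidt[OF finite_J \<Theta>, of "\<lambda>\<tau>. P (v \<tau>)"] by metis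
  let ?Q = "oproj J \<Theta> e"
  define \<rho> where "\<rho> j x = P (\<phi> j) x - ?Q (P (\<phi> j)) x" for j x
  have "ip J (\<rho> j) (\<rho> j) \<le> \<delta>\<^sup>2" if j: "j \<in> I" for j
  proof -
    from appr[OF j] obtain c where c: "L2_set (\<lambda>x. \<phi> j x - (\<Sum>\<tau>\<in>\<Theta>. c \<tau> * v \<tau> x)) J \<le> \<delta>" by blast
    let ?\<psi> = "\<lambda>x. \<Sum>\<tau>\<in>\<Theta>. c \<tau> * v \<tau> x"
    have P\<psi>: "P ?\<psi> = (\<lambda>x. \<Sum>\<tau>\<in>\<Theta>. c \<tau> * P (v \<tau>) x)"
      by (simp add: fun_eq_iff oproj_sum oproj_scale)
    have "ip J (\<rho> j) (\<rho> j) \<le> ip J (\<lambda>x. P (\<phi> j) x - P ?\<psi> x) (\<lambda>x. P (\<phi> j) x - P ?\<psi> x)"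
      unfolding \<rho>_def
    proof (rule oproj_best[OF finite_J \<Theta> os])
      show "?Q (P ?\<psi>) x = P ?\<psi> x" if "x \<in> J" for x
        unfolding P\<psi> by (simp add: oproj_sum oproj_scale span that)
    qed
    also have "\<dots> = ip J (P (\<lambda>x. \<phi> j x - ?\<psi> x)) (P (\<lambda>x. \<phi> j x - ?\<psi> x))"
      by (simp add: oproj_diff ip_def)
    also have "\<dots> \<le> ip J (\<lambda>x. \<phi> j x - ?\<psi> x) (\<lambda>x. \<phi> j x - ?\<psi> x)"
      by (rule P_norm_le)
    also have "\<dots> \<le> \<delta>\<^sup>2"
      using c unfolding L2_set_square_eq_ip[symmetric] by (intro power_mono) auto
    finally show ?thesis .
  qed
  moreover have "2 * ip J E h \<le> ip J h h + 2 * t * tv h + (\<Sum>\<tau>\<in>\<Theta>. (ip J (e \<tau>) E)\<^sup>2)"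
    if h: "\<And>i. i \<in> J \<Longrightarrow> P h i = h i" and t: "\<And>j. j \<in> I \<Longrightarrow> \<bar>ip J (\<rho> j) E\<bar> \<le> t" for E h t
  proof -
    define D where "D j = ip J (a j) h" for j
    \<comment> \<open>Both functions have the same differences by \<open>dict\<close>, so they
      differ by a function that \<open>P\<close> annihilates.\<close>
    have "P (\<lambda>x. h x - (\<Sum>j\<in>I. D j * \<phi> j x)) x = 0" for x
    proof (rule P_eq_0)
      fix i assume i: "i \<in> I"
      have "(\<Sum>j\<in>I. D j * ip J (a i) (\<phi> j)) = D i"
        using dict[OF i] finite_I i by (simp add: of_bool_def if_distrib[of "\<lambda>u. _ * u"] cong: if_cong)
      then show "ip J (a i) (\<lambda>x. h x - (\<Sum>j\<in>I. D j * \<phi> j x)) = 0"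
        by (simp add: ip_linear D_def)
    qed
    then have hP: "h x = (\<Sum>j\<in>I. D j * P (\<phi> j) x)" if "x \<in> J" for x
      using h[OF that] by (simp add: oproj_diff oproj_sum oproj_scale)
    have "?Q h = ?Q (\<lambda>x. \<Sum>j\<in>I. D j * P (\<phi> j) x)"
      using hP by (intro oproj_cong) auto
    then have "?Q h x = (\<Sum>j\<in>I. D j * ?Q (P (\<phi> j)) x)" for x
      by (simp add: oproj_sum oproj_scale)
    then have "h x - ?Q h x = (\<Sum>j\<in>I. D j * \<rho> j x)" if "x \<in> J" for x
      using hP[OF that] by (simp add: \<rho>_def algebra_simps sum_subtractf)
    then have "ip J E (\<lambda>x. h x - ?Q h x) = ip J E (\<lambda>x. \<Sum>j\<in>I. D j * \<rho> j x)"
      by (intro ip_cong) auto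
    also have "\<dots> = (\<Sum>j\<in>I. D j * ip J (\<rho> j) E)"
      by (simp add: ip_linear ip_commute[of J E])
    also have "\<dots> \<le> (\<Sum>j\<in>I. \<bar>D j\<bar> * t)"
    proof (intro sum_mono)
      fix j assume j: "j \<in> I"
      have "D j * ip J (\<rho> j) E \<le> \<bar>D j\<bar> * \<bar>ip J (\<rho> j) E\<bar>"
        by (metis abs_ge_self abs_mult)
      also have "\<dots> \<le> \<bar>D j\<bar> * t" using t[OF j] by (intro mult_left_mono) auto
      finally show "D j * ip J (\<rho> j) E \<le> \<bar>D j\<bar> * t" .
    qed
    also have "\<dots> = t * tv h" by (simp add: tv_def D_def sum_distrib_left mult.commute)
    finally have res: "ip J E (\<lambda>x. h x - ?Q h x) \<le> t * tv h" .
    \<comment> \<open>The split is made with coefficient exactly 1 on \<open>ip J h h\<close>, the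
      amount that \<open>oracle_inequality\<close> can absorb.\<close>
    have "2 * ip J E (?Q h) = 2 * ip J (?Q E) h" by (simp add: ip_oproj_commute)
    also have "\<dots> \<le> ip J (?Q E) (?Q E) + ip J h h" by (rule two_ip_le)
    also have "ip J (?Q E) (?Q E) = (\<Sum>\<tau>\<in>\<Theta>. (ip J (e \<tau>) E)\<^sup>2)"
      unfolding ip_oproj_self[OF finite_J \<Theta> os] unfolding ip_oproj_left power2_eq_square
      by (simp add: ip_commute[of J E])
    finally show ?thesis
      using res by (simp add: ip_diff_right algebra_simps)
  qed
  ultimately show ?thesis
    using os by (intro exI[of _ e] exI[of _ \<rho>]) blast
qed

end

section \<open>The estimator and its rate\<close>

lemma tensors_eq_extensional: "tensors d N = extensional (tensor_index d N)"
  by (auto simp: tensors_def PiE_def)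

lemma analysis_operator_diff_row: "analysis_operator (tensor_index d N) (diff_index d N k)"
  by unfold_locales (rule finite_tensor_index finite_diff_index)+

context
  fixes d k :: nat and N :: "nat \<Rightarrow> nat"
begin

interpretation D: analysis_operator "tensor_index d N" "diff_index d N k" "diff_row d N k"
  by (rule analysis_operator_diff_row)

lemma diff_kernel_eq: "diff_kernel d N k = D.ker"
  by (auto simp: diff_kernel_def D.ker_def tensors_eq_extensional total_diff_eq_ip)

lemma kernel_perp_eq: "kernel_perp d N k = D.perp"
  by (simp add: kernel_perp_def D.perp_def tensors_eq_extensional diff_kernel_eq tensor_inner_def ip_def)

lemma TV_eq: "TV d N k f = D.tv f"
  by (simp add: TV_def D.tv_def total_diff_eq_ip)

lemma perp_proj_eq: "perp_proj d N k f = restrict (D.P f) (tensor_index d N)"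
  using D.perp_proj_eq[of f] by (simp add: perp_proj_def kernel_perp_eq diff_kernel_eq)

lemma frob_norm_square: "(frob_norm d N f)\<^sup>2 = ip (tensor_index d N) f f"
  by (simp add: frob_norm_def L2_set_square_eq_ip)

text \<open>Multiplying the objective by the tensor size turns the penalty level \<open>lam\<close>
  into size times \<open>lam\<close>, and on the complement \<open>P (Y - f)\<close> equals
  \<open>P Y - f\<close>. Existence of a minimizer then makes the choice in \<open>arg_min\<close>
  meaningful.\<close>

lemma estimator_minimizer:
  assumes n: "tensor_size d N > 0" and "lam \<ge> 0"
  shows "penalized_least_squares.minimizer (tensor_index d N) D.perp
           (\<lambda>f. 2 * (real (tensor_size d N) * lam) * D.tv f) (D.P Y) (estimator d N k lam Y)"
proof -
  let ?n = "real (tensor_size d N)"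
  interpret L: penalized_least_squares "tensor_index d N" D.perp "\<lambda>f. 2 * (?n * lam) * D.tv f"
    using \<open>lam \<ge> 0\<close> by (intro D.penalized_least_squares) simp
  define F where "F f = (frob_norm d N (perp_proj d N k (\<lambda>j. Y j - f j)))\<^sup>2 / ?n + 2 * lam * TV d N k f" for f
  have F: "F f = L.obj (D.P Y) f / ?n" if "f \<in> D.perp" for f
  proof -
    have "(frob_norm d N (perp_proj d N k (\<lambda>j. Y j - f j)))\<^sup>2
        = ip (tensor_index d N) (\<lambda>x. D.P Y x - f x) (\<lambda>x. D.P Y x - f x)"
      using that unfolding frob_norm_square perp_proj_eq
      by (intro ip_cong) (auto simp: oproj_diff D.perp_iff)
    then show ?thesis
      using n by (simp add: F_def L.obj_def TV_eq add_divide_distrib)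
  qed
  have arg_min_iff: "is_arg_min F (\<lambda>f. f \<in> D.perp) x \<longleftrightarrow> L.minimizer (D.P Y) x" for x
  proof -
    have "F x \<le> F y \<longleftrightarrow> L.obj (D.P Y) x \<le> L.obj (D.P Y) y" if "x \<in> D.perp" "y \<in> D.perp" for y
      unfolding F[OF that(1)] F[OF that(2)] divide_le_cancel using n by linarith
    moreover have "is_arg_min F (\<lambda>f. f \<in> D.perp) x \<longleftrightarrow> x \<in> D.perp \<and> (\<forall>y\<in>D.perp. F x \<le> F y)"
      unfolding is_arg_min_def by (auto simp: not_less)
    ultimately show ?thesis
      unfolding L.minimizer_def by blast
  qed
  have "is_arg_min F (\<lambda>f. f \<in> D.perp) (arg_min F (\<lambda>f. f \<in> D.perp))"
    unfolding arg_min_def by (rule someI_ex[of "is_arg_min F (\<lambda>f. f \<in> D.perp)"]) (simp only: arg_min_iff L.minimizer_exists)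
  then have "L.minimizer (D.P Y) (arg_min F (\<lambda>f. f \<in> D.perp))"
    by (simp only: arg_min_iff)
  moreover have "arg_min F (\<lambda>f. f \<in> D.perp) = estimator d N k lam Y"
    unfolding estimator_def kernel_perp_eq F_def ..
  ultimately show ?thesis by simp
qed

text \<open>Projection and penalized minimization are both nonexpansive, so each coordinate of the
  estimator is a Lipschitz function of the noise.\<close>

lemma estimator_event_measurable:
  assumes n: "tensor_size d N > 0" and lam: "lam \<ge> 0"
    and \<epsilon>: "\<And>j. j \<in> tensor_index d N \<Longrightarrow> \<epsilon> j \<in> borel_measurable M"
  shows "{\<omega> \<in> space M. (frob_norm d N (\<lambda>j. estimator d N k lam (\<lambda>i. f0 i + \<epsilon> i \<omega>) j - p j))\<^sup>2 / c \<le> T} \<in> sets M"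
proof -
  let ?J = "tensor_index d N" and ?n = "real (tensor_size d N)"
  interpret L: penalized_least_squares ?J D.perp "\<lambda>f. 2 * (?n * lam) * D.tv f"
    using lam by (intro D.penalized_least_squares) simp
  have [measurable]: "(\<lambda>\<omega>. estimator d N k lam (\<lambda>i. f0 i + \<epsilon> i \<omega>) j) \<in> borel_measurable M" if "j \<in> ?J" for j
  proof (rule measurable_lipschitz_comp[where J = ?J and X = \<epsilon>])
    fix y y' :: "(nat \<Rightarrow> nat) \<Rightarrow> real"
    let ?Y = "\<lambda>i. f0 i + y i" and ?Y' = "\<lambda>i. f0 i + y' i"
    let ?x = "estimator d N k lam ?Y" and ?x' = "estimator d N k lam ?Y'"
    have "(?x j - ?x' j)\<^sup>2 \<le> ip ?J (\<lambda>i. ?x i - ?x' i) (\<lambda>i. ?x i - ?x' i)"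
      by (rule square_le_ip_self[OF finite_tensor_index that])
    also have "\<dots> \<le> ip ?J (\<lambda>i. D.P ?Y i - D.P ?Y' i) (\<lambda>i. D.P ?Y i - D.P ?Y' i)"
      by (intro L.minimizer_nonexpansive estimator_minimizer n lam)
    also have "\<dots> = ip ?J (D.P (\<lambda>i. ?Y i - ?Y' i)) (D.P (\<lambda>i. ?Y i - ?Y' i))"
      by (intro ip_cong) (simp_all only: oproj_diff)
    also have "\<dots> \<le> ip ?J (\<lambda>i. ?Y i - ?Y' i) (\<lambda>i. ?Y i - ?Y' i)"
      by (rule D.P_norm_le)
    finally show "(?x j - ?x' j)\<^sup>2 \<le> ip ?J (\<lambda>i. y i - y' i) (\<lambda>i. y i - y' i)" by simp
  qed (use \<epsilon> finite_tensor_index in auto)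
  show ?thesis
    unfolding frob_norm_square ip_def by measurable
qed

end

lemma gaussian_vector_noise:
  assumes "gaussian_noise M d N \<sigma> \<epsilon>" "\<sigma> > 0"
  shows "gaussian_vector M (tensor_index d N) \<epsilon> \<sigma>"
  using assms finite_tensor_index
  by (auto simp: gaussian_noise_def gaussian_vector_def gaussian_vector_axioms_def)

lemma card_tensor_index: "card (tensor_index d N) = tensor_size d N"
  by (simp add: tensor_index_def tensor_size_def card_PiE)

text \<open>The failure probability is \<open>2 / n\<^sup>2\<close> for each of at most
  \<open>n\<close> residuals plus \<open>1 / n\<close> for the chi-square variable. Outside these
  events the argument is deterministic.\<close>

lemma oracle_bound_probability:
  fixes d k m n :: nat and \<sigma> lam \<delta> :: real and M :: "'a measure" and \<Theta> :: "'t set"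
  assumes k: "k \<ge> 1" and n: "n = m ^ d" "n \<ge> 3" and \<sigma>: "\<sigma> > 0" and noise: "gaussian_noise M d (\<lambda>_. m) \<sigma> \<epsilon>"
    and \<Theta>: "finite \<Theta>" and \<delta>: "\<delta> > 0"
    and appr: "\<And>j. j \<in> diff_index d (\<lambda>_. m) k \<Longrightarrow> \<exists>c.
      L2_set (\<lambda>x. tensor_tpow d m k j x - (\<Sum>\<tau>\<in>\<Theta>. c \<tau> * v \<tau> x)) (tensor_index d (\<lambda>_. m)) \<le> \<delta>"
    and lam: "2 * \<sigma> * \<delta> * sqrt (ln (real n)) \<le> real n * lam"
    and T: "(frob_norm d (\<lambda>_. m) (\<lambda>j. g j - perp_proj d (\<lambda>_. m) k f0 j))\<^sup>2 / real n + 4 * lam * TV d (\<lambda>_. m) k g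
            + 4 * \<sigma>\<^sup>2 * (real (card \<Theta>) + ln (real n)) / real n \<le> T"
  shows "measure M {\<omega> \<in> space M.
           (frob_norm d (\<lambda>_. m) (\<lambda>j. estimator d (\<lambda>_. m) k lam (\<lambda>i. f0 i + \<epsilon> i \<omega>) j
                                     - perp_proj d (\<lambda>_. m) k f0 j))\<^sup>2 / real n \<le> T} \<ge> 1 - 3 / real n"
proof -
  let ?J = "tensor_index d (\<lambda>_. m)" and ?I = "diff_index d (\<lambda>_. m) k"
  interpret D: analysis_operator ?J ?I "diff_row d (\<lambda>_. m) k"
    by (rule analysis_operator_diff_row)
  interpret gaussian_vector M ?J \<epsilon> \<sigma>
    by (rule gaussian_vector_noise[OF noise \<sigma>])
  have size: "tensor_size d (\<lambda>_. m) = n" by (simp add: tensor_size_def n)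
  have ln_pos: "ln (real n) > 0" using n(2) by simp
  have "0 < 2 * \<sigma> * \<delta> * sqrt (ln (real n))" using \<sigma> \<delta> ln_pos by simp
  then have "real n * lam > 0" using lam by linarith
  then have lam_pos: "lam > 0" using n by (simp add: zero_less_mult_iff)
  have dict: "ip ?J (diff_row d (\<lambda>_. m) k i) (tensor_tpow d m k j) = of_bool (i = j)"
    if "i \<in> ?I" "j \<in> ?I" for i j
    using total_diff_tensor_tpow[OF k that(2,1)] total_diff_eq_ip[OF that(1)] by simp
  obtain e \<rho> where os: "orthosys ?J \<Theta> e"
    and \<rho>: "\<And>j. j \<in> ?I \<Longrightarrow> ip ?J (\<rho> j) (\<rho> j) \<le> \<delta>\<^sup>2"
    and dec: "\<And>E h t. (\<And>i. i \<in> ?J \<Longrightarrow> D.P h i = h i) \<Longrightarrow> (\<And>j. j \<in> ?I \<Longrightarrow> \<bar>ip ?J (\<rho> j) E\<bar> \<le> t) \<Longrightarrow>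
       2 * ip ?J E h \<le> ip ?J h h + 2 * t * D.tv h + (\<Sum>\<tau>\<in>\<Theta>. (ip ?J (e \<tau>) E)\<^sup>2)"
    using D.noise_decomposition[OF dict \<Theta> appr] by blast
  \<comment> \<open>Chosen so that the tail bound for a residual of norm at most
    \<open>\<delta>\<close> has exponent \<open>2 * ln n\<close>, leaving one factor
    \<open>1 / n\<close> after the union bound.\<close>
  define t where "t = 2 * \<sigma> * \<delta> * sqrt (ln (real n))"
  have t0: "t \<ge> 0" using \<sigma> \<delta> ln_pos by (simp add: t_def)
  define B where "B j = {\<omega> \<in> space M. t \<le> \<bar>ip ?J (\<rho> j) (\<lambda>x. \<epsilon> x \<omega>)\<bar>}" for j
  define B' where "B' = {\<omega> \<in> space M. 4 * \<sigma>\<^sup>2 * (real (card \<Theta>) + ln (real n)) \<le> (\<Sum>\<tau>\<in>\<Theta>. (ip ?J (e \<tau>) (\<lambda>x. \<epsilon> x \<omega>))\<^sup>2)}"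
  have [measurable]: "B j \<in> sets M" "B' \<in> sets M" for j
    unfolding B_def B'_def by measurable
  have pB: "prob (B j) \<le> 2 / (real n)\<^sup>2" if "j \<in> ?I" for j
  proof -
    have "t\<^sup>2 = 4 * \<sigma>\<^sup>2 * \<delta>\<^sup>2 * ln (real n)"
      using ln_pos by (simp add: t_def power_mult_distrib)
    then have "- t\<^sup>2 / (2 * \<sigma>\<^sup>2 * \<delta>\<^sup>2) = - (2 * ln (real n))"
      using \<sigma> \<delta> by simp
    moreover have "exp (- (2 * ln (real n))) = 1 / (real n)\<^sup>2"
      using n(2) by (simp add: exp_minus exp_double inverse_eq_divide)
    ultimately show ?thesis
      using prob_abs_ip_ge[OF \<rho>[OF that] \<delta> t0] by (simp add: B_def)
  qed
  have pB': "prob B' \<le> 1 / real n"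
    using prob_chi_square_ge[OF \<Theta> os, of "ln (real n)"] ln_pos n(2)
    by (simp add: B'_def exp_minus inverse_eq_divide)
  have "card ?I \<le> card ?J"
    by (intro card_mono finite_tensor_index diff_index_subset)
  then have cardI: "card ?I \<le> n" by (simp add: card_tensor_index size)
  have "prob (\<Union>j\<in>?I. B j) \<le> (\<Sum>j\<in>?I. prob (B j))"
    by (intro finite_measure_subadditive_finite finite_diff_index) auto
  also have "\<dots> \<le> real (card ?I) * (2 / (real n)\<^sup>2)"
    using pB by (intro sum_bounded_above) auto
  also have "\<dots> \<le> real n * (2 / (real n)\<^sup>2)"
    using cardI by (intro mult_right_mono) auto
  also have "\<dots> = 2 / real n" by (simp add: power2_eq_square)
  finally have "prob (\<Union>j\<in>?I. B j) \<le> 2 / real n" .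
  moreover have "prob (B' \<union> (\<Union>j\<in>?I. B j)) \<le> prob B' + prob (\<Union>j\<in>?I. B j)"
    by (intro measure_Un_le) (auto intro!: sets.finite_UN finite_diff_index)
  ultimately have bad: "prob (B' \<union> (\<Union>j\<in>?I. B j)) \<le> 3 / real n"
    using pB' by (simp add: field_simps)
  let ?G = "{\<omega> \<in> space M.
           (frob_norm d (\<lambda>_. m) (\<lambda>j. estimator d (\<lambda>_. m) k lam (\<lambda>i. f0 i + \<epsilon> i \<omega>) j
                                     - perp_proj d (\<lambda>_. m) k f0 j))\<^sup>2 / real n \<le> T}"
  have "space M - (B' \<union> (\<Union>j\<in>?I. B j)) \<subseteq> ?G"
  proof
    fix \<omega> assume \<omega>: "\<omega> \<in> space M - (B' \<union> (\<Union>j\<in>?I. B j))"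
    let ?E = "\<lambda>x. \<epsilon> x \<omega>"
    have small: "\<bar>ip ?J (\<rho> j) ?E\<bar> \<le> t" if "j \<in> ?I" for j
      using \<omega> that by (auto simp: B_def)
    have chi: "(\<Sum>\<tau>\<in>\<Theta>. (ip ?J (e \<tau>) ?E)\<^sup>2) \<le> 4 * \<sigma>\<^sup>2 * (real (card \<Theta>) + ln (real n))"
      using \<omega> by (auto simp: B'_def)
    define T' where "T' = 4 * \<sigma>\<^sup>2 * (real (card \<Theta>) + ln (real n))"
    let ?x = "estimator d (\<lambda>_. m) k lam (\<lambda>i. f0 i + ?E i)"
    have "ip ?J (\<lambda>i. ?x i - D.P f0 i) (\<lambda>i. ?x i - D.P f0 i)
        \<le> ip ?J (\<lambda>i. g i - D.P f0 i) (\<lambda>i. g i - D.P f0 i) + 4 * (real n * lam) * D.tv g + T'"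
    proof (rule D.oracle_inequality)
      show "penalized_least_squares.minimizer ?J D.perp (\<lambda>f. 2 * (real n * lam) * D.tv f) (D.P (\<lambda>i. f0 i + ?E i)) ?x"
        using estimator_minimizer[of d "\<lambda>_. m" lam k "\<lambda>i. f0 i + ?E i"] lam_pos n(2) by (simp add: size)
      fix h assume h: "\<And>i. i \<in> ?J \<Longrightarrow> D.P h i = h i"
      have "2 * ip ?J ?E h \<le> ip ?J h h + 2 * t * D.tv h + (\<Sum>\<tau>\<in>\<Theta>. (ip ?J (e \<tau>) ?E)\<^sup>2)"
        by (intro dec h small)
      also have "\<dots> \<le> ip ?J h h + 2 * (real n * lam) * D.tv h + T'"
        using lam chi D.tv_nonneg[of h] unfolding T'_def t_def[symmetric]
        by (intro add_mono mult_right_mono) auto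
      finally show "2 * ip ?J ?E h \<le> ip ?J h h + 2 * (real n * lam) * D.tv h + T'" .
    qed (use lam_pos in auto)
    moreover have "(frob_norm d (\<lambda>_. m) (\<lambda>j. f j - perp_proj d (\<lambda>_. m) k f0 j))\<^sup>2
        = ip ?J (\<lambda>i. f i - D.P f0 i) (\<lambda>i. f i - D.P f0 i)" for f
      unfolding frob_norm_square perp_proj_eq by (intro ip_cong) auto
    ultimately have "(frob_norm d (\<lambda>_. m) (\<lambda>j. ?x j - perp_proj d (\<lambda>_. m) k f0 j))\<^sup>2 / real n
        \<le> ((frob_norm d (\<lambda>_. m) (\<lambda>j. g j - perp_proj d (\<lambda>_. m) k f0 j))\<^sup>2 + 4 * (real n * lam) * D.tv g + T') / real n"
      by (intro divide_right_mono) auto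
    also have "\<dots> \<le> T"
      using T n(2) by (simp add: TV_eq T'_def add_divide_distrib)
    finally show "\<omega> \<in> ?G" using \<omega> by simp
  qed
  moreover have "?G \<in> sets M"
    using lam_pos n(2) by (intro estimator_event_measurable) (auto simp: size)
  ultimately have "prob (space M - (B' \<union> (\<Union>j\<in>?I. B j))) \<le> prob ?G"
    by (intro finite_measure_mono)
  moreover have "prob (space M - (B' \<union> (\<Union>j\<in>?I. B j))) = 1 - prob (B' \<union> (\<Union>j\<in>?I. B j))"
    by (intro prob_compl) (auto intro!: sets.finite_UN finite_diff_index)
  ultimately show ?thesis using bad by linarith
qed

section \<open>Arithmetic of the rate and choice of constants\<close>

lemma rate_denominator_pos:
  assumes "d \<ge> 1" "k \<ge> 1"
  shows "0 < 2 * harm d + 2 * real k - 1"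
proof -
  have "(harm d :: real) > 0" using assms by (intro harm_pos) auto
  moreover have "real k \<ge> 1" using assms by simp
  ultimately show ?thesis by linarith
qed

lemma rate_times_size:
  assumes "d \<ge> 1" "k \<ge> 1" "n \<ge> 2"
  shows "real n * rate d k n = (real n * ln (real n)) powr (harm d / (2 * harm d + 2 * real k - 1))"
proof -
  define p where "p = 2 * harm d + 2 * real k - 1"
  have p: "p > 0" using rate_denominator_pos assms by (simp add: p_def)
  have "real n * real n powr (- ((harm d + 2 * real k - 1) / p)) = real n powr (1 - (harm d + 2 * real k - 1) / p)"
    using assms by (simp add: powr_diff powr_minus field_simps)
  also have "1 - (harm d + 2 * real k - 1) / p = harm d / p"
    using p by (simp add: field_simps p_def)
  finally have "real n * rate d k n = real n powr (harm d / p) * ln (real n) powr (harm d / p)"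
    unfolding rate_def p_def[symmetric] mult.assoc[symmetric] by (rule arg_cong)
  also have "\<dots> = (real n * ln (real n)) powr (harm d / p)"
    using assms by (simp add: powr_mult)
  finally show ?thesis by (simp only: p_def)
qed

text \<open>The balance equation for \<open>L = n * ln n\<close>: the approximation error, including
  its logarithmic factor, has the order of the dimension exactly at \<open>S\<close>.\<close>

lemma sqrt_times_powr_rate:
  fixes L :: real
  assumes "d \<ge> 1" "k \<ge> 1" "L > 0"
  defines "S \<equiv> L powr (harm d / (2 * harm d + 2 * real k - 1))"
  shows "sqrt L * S powr (- (real k - 1/2) / harm d) = S"
proof -
  define p where "p = 2 * harm d + 2 * real k - 1"
  have p: "p > 0" using rate_denominator_pos assms by (simp add: p_def)
  have H: "(harm d :: real) > 0" using assms by (intro harm_pos) auto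
  have "sqrt L * S powr (- (real k - 1/2) / harm d) = L powr (1/2 + harm d / p * (- (real k - 1/2) / harm d))"
    using assms by (simp add: S_def powr_powr powr_add powr_half_sqrt p_def)
  also have "1/2 + harm d / p * (- (real k - 1/2) / harm d) = (p / 2 - (real k - 1/2)) / p"
  proof -
    have "(harm d :: real) \<noteq> 0" using H by linarith
    then have "harm d / p * (- (real k - 1/2) / harm d) = - (real k - 1/2) / p" by simp
    then show ?thesis using p by (simp only:) (simp add: field_simps)
  qed
  also have "p / 2 - (real k - 1/2) = harm d"
  proof -
    have "(2 * h + 2 * real k - 1) / 2 - (real k - 1/2) = h" for h :: real
      by (simp add: field_simps)
    then show ?thesis by (simp only: p_def)
  qed
  finally show ?thesis by (simp add: S_def p_def)
qed

theorem theorem3p2: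
  fixes d k :: nat and \<sigma> B c1 c2 :: real
  assumes "d \<ge> 1" and "k \<ge> 1" and "\<sigma> > 0" and "0 < c1" and "c1 \<le> c2"
  shows "\<exists>C>0. \<exists>C'>0. \<forall>m n. k \<le> m - 1 \<longrightarrow> n = m ^ d \<longrightarrow>
    (\<forall>(M :: 'a measure) \<epsilon> f0 g lam.
       gaussian_noise M d (\<lambda>_. m) \<sigma> \<epsilon> \<longrightarrow>
       f0 \<in> tensors d (\<lambda>_. m) \<longrightarrow>
       g \<in> tensors d (\<lambda>_. m) \<longrightarrow>
       TV d (\<lambda>_. m) k g \<le> B \<longrightarrow>
       c1 * rate d k n \<le> lam \<longrightarrow> lam \<le> c2 * rate d k n \<longrightarrow>
       measure M {\<omega> \<in> space M.
           (frob_norm d (\<lambda>_. m) (\<lambda>j. estimator d (\<lambda>_. m) k lam (\<lambda>i. f0 i + \<epsilon> i \<omega>) j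
                                     - perp_proj d (\<lambda>_. m) k f0 j))\<^sup>2 / real n
           \<le> (frob_norm d (\<lambda>_. m) (\<lambda>j. g j - perp_proj d (\<lambda>_. m) k f0 j))\<^sup>2 / real n
             + C * rate d k n}
         \<ge> 1 - C' / real n)"
proof -
  define q where "q = - (real k - 1/2) / harm d"
  define a where "a = harm d / (2 * harm d + 2 * real k - 1)"
  have H: "(harm d :: real) > 0" using assms by (intro harm_pos) auto
  have q: "q < 0" using H \<open>k \<ge> 1\<close> by (simp add: q_def divide_less_0_iff)
  have a: "a > 0" using H rate_denominator_pos assms by (simp add: a_def)
  obtain C1 C2 :: real where C1: "C1 > 0" and C2: "C2 > 0" and
    appr: "\<And>m X. m > 0 \<Longrightarrow> X > 0 \<Longrightarrow> \<exists>\<Theta>. finite \<Theta> \<and> real (card \<Theta>) \<le> C1 * X \<and>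
       (\<forall>j. (\<forall>i\<in>{1..d}. 2 \<le> j i) \<longrightarrow> (\<exists>c.
          L2_set (\<lambda>x. tensor_tpow d m k j x - (\<Sum>\<tau>\<in>\<Theta>. c \<tau> * atom d m \<tau> x)) (tensor_index d (\<lambda>_. m))
          \<le> sqrt (real (m ^ d)) * (C2 * X powr q)))"
    by (rule tensor_tpow_approximation[OF assms(1,2), folded q_def]) (rule that)
  \<comment> \<open>With \<open>X = A * S\<close>, this makes the noise level
    \<open>2 * \<sigma> * \<delta> * sqrt (ln n)\<close> equal to \<open>c1 * S\<close>, the
    smallest admissible value of \<open>n * lam\<close>.\<close>
  define A where "A = (c1 / (2 * \<sigma> * C2)) powr (1 / q)"
  have A: "A > 0" using assms C2 by (simp add: A_def)
  have Aq: "A powr q = c1 / (2 * \<sigma> * C2)"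
    using assms C2 q by (simp add: A_def powr_powr)
  \<comment> \<open>The summands come from the penalty of \<open>g\<close>, the dimension
    \<open>C1 * A * S\<close> and the bound \<open>ln n \<le> S / a\<close>. The maximum keeps
    \<open>C\<close> positive for every \<open>B\<close>.\<close>
  define C where "C = 4 * c2 * max B 0 + 4 * \<sigma>\<^sup>2 * (C1 * A + 1 / a)"
  have C: "C > 0"
    unfolding C_def using assms C1 A a by (intro add_nonneg_pos mult_pos_pos add_pos_pos) auto
  show ?thesis
  proof (rule exI[of _ C], intro conjI C, rule exI[of _ 3], intro conjI allI impI)
    fix m n :: nat and M :: "'a measure" and \<epsilon> f0 g lam
    assume m: "k \<le> m - 1" and n: "n = m ^ d" and noise: "gaussian_noise M d (\<lambda>_. m) \<sigma> \<epsilon>"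
      and TVg: "TV d (\<lambda>_. m) k g \<le> B" and lam: "c1 * rate d k n \<le> lam" "lam \<le> c2 * rate d k n"
    let ?R = "(frob_norm d (\<lambda>_. m) (\<lambda>j. g j - perp_proj d (\<lambda>_. m) k f0 j))\<^sup>2 / real n"
    have m0: "m > 0" using m \<open>k \<ge> 1\<close> by simp
    then have n0: "n > 0" by (simp add: n)
    show "1 - 3 / real n \<le> measure M {\<omega> \<in> space M.
           (frob_norm d (\<lambda>_. m) (\<lambda>j. estimator d (\<lambda>_. m) k lam (\<lambda>i. f0 i + \<epsilon> i \<omega>) j
                                     - perp_proj d (\<lambda>_. m) k f0 j))\<^sup>2 / real n \<le> ?R + C * rate d k n}"
    proof (cases "n \<ge> 3")
      \<comment> \<open>For \<open>n\<close> below 3 the claimed lower bound is not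
        positive.\<close>
      case False
      then have "1 - 3 / real n \<le> 0" using n0 by (simp add: field_simps)
      then show ?thesis using measure_nonneg order_trans by blast
    next
      case True
      \<comment> \<open>From 3 on the logarithm is at least 1, so \<open>n powr a\<close> is at most
        \<open>S\<close>.\<close>
      have "exp 1 \<le> real n" using True exp_le by linarith
      then have ln1: "ln (real n) \<ge> 1" using n0 by (subst ln_ge_iff) auto
      define S where "S = (real n * ln (real n)) powr a"
      have L: "real n * ln (real n) > 0" using n0 ln1 by (intro mult_pos_pos, simp, linarith)
      have S: "S > 0" using L unfolding S_def powr_gt_zero by linarith
      have nrate: "real n * rate d k n = S"
        unfolding S_def a_def using True assms by (intro rate_times_size) auto
      then have rate: "rate d k n = S / real n" using n0 by (simp add: field_simps)
      have Sq: "sqrt (real n * ln (real n)) * S powr q = S"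
        unfolding S_def a_def q_def using sqrt_times_powr_rate[OF assms(1,2) L] by simp
      define X where "X = A * S"
      have X: "X > 0" using A S by (simp add: X_def)
      obtain \<Theta> where \<Theta>: "finite \<Theta>" "real (card \<Theta>) \<le> C1 * X" and
        ap: "\<forall>j. (\<forall>i\<in>{1..d}. 2 \<le> j i) \<longrightarrow> (\<exists>c.
          L2_set (\<lambda>x. tensor_tpow d m k j x - (\<Sum>\<tau>\<in>\<Theta>. c \<tau> * atom d m \<tau> x)) (tensor_index d (\<lambda>_. m))
          \<le> sqrt (real (m ^ d)) * (C2 * X powr q))"
        using appr[OF m0 X] by blast
      define \<delta> where "\<delta> = sqrt (real n) * (C2 * X powr q)"
      have \<delta>: "\<delta> > 0" using n0 C2 X by (simp add: \<delta>_def)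
      show ?thesis
      proof (rule oracle_bound_probability[OF assms(2) n True assms(3) noise \<Theta>(1) \<delta>, where v = "atom d m" and g = g])
        fix j assume j: "j \<in> diff_index d (\<lambda>_. m) k"
        show "\<exists>c. L2_set (\<lambda>x. tensor_tpow d m k j x - (\<Sum>\<tau>\<in>\<Theta>. c \<tau> * atom d m \<tau> x)) (tensor_index d (\<lambda>_. m)) \<le> \<delta>"
          unfolding \<delta>_def n
        proof (rule ap[rule_format])
          show "2 \<le> j i" if "i \<in> {1..d}" for i
            using diff_index_ge[OF j that] \<open>k \<ge> 1\<close> by simp
        qed
      next
        have "2 * \<sigma> * \<delta> * sqrt (ln (real n))
            = 2 * \<sigma> * C2 * A powr q * (sqrt (real n * ln (real n)) * S powr q)"
          using A S by (simp add: \<delta>_def X_def powr_mult real_sqrt_mult)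
        also have "\<dots> = c1 * S"
          unfolding Sq Aq using assms C2 by simp
        also have "\<dots> = real n * (c1 * rate d k n)"
          using nrate by simp
        also have "\<dots> \<le> real n * lam"
          using lam by (intro mult_left_mono) auto
        finally show "2 * \<sigma> * \<delta> * sqrt (ln (real n)) \<le> real n * lam" .
      next
        have rate0: "rate d k n > 0" using S n0 by (simp add: rate)
        have "lam * TV d (\<lambda>_. m) k g \<le> (c2 * rate d k n) * max B 0"
        proof (rule mult_mono[OF lam(2)])
          show "0 \<le> TV d (\<lambda>_. m) k g" by (simp add: TV_def sum_nonneg)
          show "0 \<le> c2 * rate d k n" using assms rate0 by simp
        qed (use TVg in simp)
        moreover have "real (card \<Theta>) + ln (real n) \<le> (C1 * A + 1 / a) * S"
        proof -
          have "ln (real n) \<le> real n powr a / a"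
            using n0 a by (intro ln_powr_bound) auto
          also have "real n powr a / a \<le> S / a"
            unfolding S_def using a n0 ln1 by (intro divide_right_mono powr_mono2) auto
          finally show ?thesis using \<Theta>(2) by (simp add: X_def algebra_simps)
        qed
        then have "4 * \<sigma>\<^sup>2 * (real (card \<Theta>) + ln (real n)) / real n
            \<le> 4 * \<sigma>\<^sup>2 * ((C1 * A + 1 / a) * S) / real n"
          by (intro divide_right_mono mult_left_mono) auto
        moreover have C_rate: "(4 * c2 * max B 0 + 4 * \<sigma>\<^sup>2 * Z) * (S / real n)
            = 4 * (c2 * (S / real n) * max B 0) + 4 * \<sigma>\<^sup>2 * (Z * S) / real n" for Z
          by (simp add: algebra_simps)
        ultimately show "?R + 4 * lam * TV d (\<lambda>_. m) k g + 4 * \<sigma>\<^sup>2 * (real (card \<Theta>) + ln (real n)) / real n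
            \<le> ?R + C * rate d k n"
          unfolding C_def rate C_rate by linarith
      qed
    qed
  qed simp
qed

end
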